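(* Consider the following method with line search. Choose $0 < H_0 \le L_2$, $x_0 \in \mathrm{dom}\,\psi$, and $F'_0\in\partial F(x_0)$. At iteration $k\ge0$: (1) set $g_k = \|F'_k\|_*$; (2) find the least integer $i = i_k \ge 0$ such that for $H = 2^i H_k$ and $T = T_{A_H(x_k)}(x_k)$, where $A_H(x_k) = \frac1\sigma\sqrt{\frac{H}{3}g_k}$, one has $$f(T) \le f(x_k) + \langle \nabla f(x_k), T - x_k\rangle + \tfrac12\langle \nabla^2 f(x_k)(T-x_k), T-x_k\rangle + \tfrac{H}{6}\|T - x_k\|^3;$$ (3) set $A_k = \frac1\sigma\sqrt{\frac{2^{i_k}}{3}H_k g_k}$, $x_{k+1} = T_{A_k}(x_k)$, $H_{k+1} = \max\{H_0, 2^{i_k-1}H_k\}$, and $$F'_{k+1} = \nabla f(x_{k+1}) - \nabla f(x_k) - \nabla^2 f(x_k)(x_{k+1} - x_k) - A_k(\nabla d(x_{k+1}) - \nabla d(x_k)).$$ Let $x^*$ be a minimizer of $F$ on $\mathrm{dom}\,\psi$, $F^*=F(x^* )$, assume $D = \sup_{x\in\mathrm{dom}\,\psi}\{\|x - x^*\| : F(x)\le F(x_0)\} < +\infty$, let $\epsilon>0$, and suppose $F(x_k) - F^* \ge \epsilon$ for some iteration $k\ge0$. Then $$k \;\le\; 4c_0^2\sqrt{\frac{2L_2D^3}{3\epsilon}} + \ln\frac{(F(x_0)-F^* )\,\|F'_0\|_*^{1/2}D^{1/2}}{\epsilon^{3/2}}, \qquad c_0 = \sigma^{-1} + \frac{3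L_2}{2H_0}.$$
   Context: $\mathbb{E}$ is a finite-dimensional real vector space with an arbitrary norm $\|\cdot\|$; $\mathbb{E}^*$ is its dual with dual norm $\|g\|_* = \max\{\langle g, x\rangle : \|x\|\le 1\}$; for a self-adjoint linear operator $B:\mathbb{E}\to\mathbb{E}^*$, $\|B\| = \max\{|\langle Bx,x\rangle| : \|x\|\le 1\}$. $F = f + \psi$, where $\psi$ is a closed convex function with $\mathrm{dom}\,\psi \subseteq \mathbb{E}$ and $f$ is convex and twice continuously differentiable with $\|\nabla^2 f(x) - \nabla^2 f(y)\| \le L_2\|x-y\|$ for all $x,y\in\mathrm{dom}\,\psi$, where $L_2>0$. The scaling function $d$ is differentiable and satisfies, for some $\sigma\in(0,1]$ and all $x,y \in \mathrm{dom}\,\psi$: $d(y) \ge d(x) + \langle \nabla d(x), y-x\rangle + \frac{\sigma}{2}\|y-x\|^2$ and $\|\nabla d(x) - \nabla d(y)\|_* \le \|x-y\|$. Bregman distance: $\rho(x,y) = d(y) - d(x) - \langle \nabla d(x), y-x\rangle$. For $\bar x\in\mathrm{dom}\,\psi$ and $A>0$, $$T_A(\bar x) = \arg\min_{y\in\mathrm{dom}\,\psi}\Big[ f(\bar x) + \langle \nabla f(\bar x), y-\bar x\rangle + \tfrac12 \langle \nabla^2 f(\bar x)(y-\bar x), y-\bar x\rangle + A\rho(\bar x,y) + \psi(y)\Big].$$ *)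

theory Defs
  imports "HOL-Analysis.Analysis"
begin

text \<open>The space E is modelled by a Euclidean type 'a; the dual space E* is identified
with 'a via the inner product, so the pairing is g \<bullet> x. The (arbitrary) norm of E is
an explicit function nrm.\<close>

definition is_norm :: "('a::euclidean_space \<Rightarrow> real) \<Rightarrow> bool" where
  "is_norm nrm \<longleftrightarrow> (\<forall>x. nrm x \<ge> 0) \<and> (\<forall>x. nrm x = 0 \<longleftrightarrow> x = 0)
     \<and> (\<forall>c x. nrm (c *\<^sub>R x) = \<bar>c\<bar> * nrm x) \<and> (\<forall>x y. nrm (x + y) \<le> nrm x + nrm y)"

definition dual_norm :: "('a::euclidean_space \<Rightarrow> real) \<Rightarrow> 'a \<Rightarrow> real" where
  "dual_norm nrm g = Sup {g \<bullet> x | x. nrm x \<le> 1}"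

text \<open>Norm of a (self-adjoint) operator B : E \<rightarrow> E*.\<close>
definition op_norm :: "('a::euclidean_space \<Rightarrow> real) \<Rightarrow> ('a \<Rightarrow> 'a) \<Rightarrow> real" where
  "op_norm nrm B = Sup {\<bar>B x \<bullet> x\<bar> | x. nrm x \<le> 1}"

definition bregman :: "('a::euclidean_space \<Rightarrow> real) \<Rightarrow> ('a \<Rightarrow> 'a) \<Rightarrow> 'a \<Rightarrow> 'a \<Rightarrow> real" where
  "bregman d gd x y = d y - d x - gd x \<bullet> (y - x)"

definition model ::
  "('a::euclidean_space \<Rightarrow> real) \<Rightarrow> ('a \<Rightarrow> 'a) \<Rightarrow> ('a \<Rightarrow> 'a \<Rightarrow> 'a) \<Rightarrow>
   ('a \<Rightarrow> real) \<Rightarrow> ('a \<Rightarrow> 'a) \<Rightarrow> ('a \<Rightarrow> real) \<Rightarrow> real \<Rightarrow> 'a \<Rightarrow> 'a \<Rightarrow> real" where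
  "model f gf Hf d gd \<psi> A xb y =
     f xb + gf xb \<bullet> (y - xb) + 1/2 * (Hf xb (y - xb) \<bullet> (y - xb)) + A * bregman d gd xb y + \<psi> y"

text \<open>T_A(xb): argmin of the model over dom psi = Q.\<close>
definition Tmap ::
  "('a::euclidean_space \<Rightarrow> real) \<Rightarrow> ('a \<Rightarrow> 'a) \<Rightarrow> ('a \<Rightarrow> 'a \<Rightarrow> 'a) \<Rightarrow>
   ('a \<Rightarrow> real) \<Rightarrow> ('a \<Rightarrow> 'a) \<Rightarrow> ('a \<Rightarrow> real) \<Rightarrow> 'a set \<Rightarrow> real \<Rightarrow> 'a \<Rightarrow> 'a" where
  "Tmap f gf Hf d gd \<psi> Q A xb = arg_min (model f gf Hf d gd \<psi> A xb) (\<lambda>y. y \<in> Q)"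

text \<open>Subdifferential of F (finite exactly on Q).\<close>
definition subdiff :: "('a::euclidean_space \<Rightarrow> real) \<Rightarrow> 'a set \<Rightarrow> 'a \<Rightarrow> 'a set" where
  "subdiff F Q x = {g. \<forall>y\<in>Q. F y \<ge> F x + g \<bullet> (y - x)}"

end

theory Submission
  imports Defs
begin

text \<open>
  Write \<open>\<delta>\<^sub>j = F(x\<^sub>j) - F\<^sup>*\<close>, \<open>r = \<parallel>x\<^sub>j\<^sub>+\<^sub>1 - x\<^sub>j\<parallel>\<close> and \<open>M = 2\<^bsup>i\<^esup> H\<^sub>j\<close>, where the line search
  guarantees \<open>H\<^sub>0 \<le> M \<le> 2 L\<close>. Optimality of the step gives \<open>\<sigma> A r \<le> g\<^sub>j\<close>, that is,
  \<open>M r \<le> 3 \<sigma> A\<close>, so the cubic error of the model eats up at most half of the decrease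
  \<open>\<sigma> A r\<^sup>2\<close>.

  The Hessian is assumed Lipschitz only as a quadratic form and only between points of
  \<open>Q\<close>. Therefore the residual \<open>\<nabla>f(x + h) - \<nabla>f(x) - \<nabla>\<^sup>2f(x)h\<close> has dual norm at most \<open>L r\<^sup>2\<close> in
  general (polarization costs a factor 2), while the expected \<open>L r\<^sup>2 / 2\<close> is available when it is
  paired with \<open>x + h - z\<close>, \<open>z \<in> Q\<close>. The first bound is used for \<open>g\<^sub>j\<^sub>+\<^sub>1\<close>, the second one for
  \<open>\<delta>\<^sub>j\<^sub>+\<^sub>1\<close>; since \<open>M \<le> 2 L\<close> leaves room for the lost factor, together they still yield
  \<open>\<delta>\<^sub>j\<^sub>+\<^sub>1\<^sup>3 g\<^sub>j\<^sub>+\<^sub>1 \<le> K\<^sup>2 g\<^sub>j (\<delta>\<^sub>j - \<delta>\<^sub>j\<^sub>+\<^sub>1)\<^sup>2\<close> with \<open>K = 2 c\<^sub>0\<^sup>2 (2 L D\<^sup>3 / 3)\<^bsup>1/2\<^esup>\<close>.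

  By \<open>1 + ln u \<le> u\<close> this recurrence says that the potential
  \<open>2 K \<delta>\<^bsup>-1/2\<^esup> - ln \<delta> - (ln g) / 2\<close> grows by at least 1 in every step.
\<close>

section \<open>Arbitrary norms\<close>

locale norm_on =
  fixes nrm :: "'a::euclidean_space \<Rightarrow> real"
  assumes is_norm: "is_norm nrm"
begin

lemma nrm_nonneg [simp]: "0 \<le> nrm u"
  and nrm_eq_0 [simp]: "nrm u = 0 \<longleftrightarrow> u = 0"
  and nrm_scaleR [simp]: "nrm (c *\<^sub>R u) = \<bar>c\<bar> * nrm u"
  and nrm_triangle: "nrm (u + v) \<le> nrm u + nrm v"
  using is_norm by (auto simp: is_norm_def)

lemma nrm_zero [simp]: "nrm 0 = 0"
  by (subst nrm_eq_0) simp

lemma nrm_pos: "u \<noteq> 0 \<Longrightarrow> 0 < nrm u"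
  by (simp add: order_less_le)

lemma nrm_minus [simp]: "nrm (- u) = nrm u"
  using nrm_scaleR[of "-1" u] by simp

lemma nrm_minus_commute: "nrm (u - v) = nrm (v - u)"
  using nrm_minus[of "u - v"] by simp

lemma nrm_triangle_diff: "nrm (u - v) \<le> nrm u + nrm v"
  using nrm_triangle[of u "- v"] by simp

lemma nrm_sum: "finite S \<Longrightarrow> nrm (\<Sum>b\<in>S. w b) \<le> (\<Sum>b\<in>S. nrm (w b))"
proof (induction S rule: finite_induct)
  case empty
  show ?case by simp
next
  case (insert b S)
  then show ?case using nrm_triangle[of "w b" "\<Sum>b\<in>S. w b"] by simp
qed

section \<open>Equivalence with the Euclidean norm\<close>

lemma nrm_le_norm: "nrm u \<le> (\<Sum>b\<in>Basis. nrm b) * norm u"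
proof -
  have "nrm u = nrm (\<Sum>b\<in>Basis. (u \<bullet> b) *\<^sub>R b)"
    by (simp add: euclidean_representation)
  also have "\<dots> \<le> (\<Sum>b\<in>Basis. \<bar>u \<bullet> b\<bar> * nrm b)"
    using nrm_sum[OF finite_Basis, of "\<lambda>b. (u \<bullet> b) *\<^sub>R b"] by simp
  also have "\<dots> \<le> (\<Sum>b\<in>Basis. norm u * nrm b)"
    by (intro sum_mono mult_right_mono) (auto simp: Basis_le_norm)
  finally show ?thesis by (simp add: sum_distrib_left mult.commute)
qed

lemma continuous_on_nrm: "continuous_on S nrm"
proof (rule continuous_on_subset)
  define C where "C = (\<Sum>b\<in>Basis. nrm (b::'a))"
  have "C \<ge> 0" unfolding C_def by (intro sum_nonneg) auto
  have "C-lipschitz_on UNIV nrm"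
  proof (rule lipschitz_onI)
    fix u v :: 'a
    have "nrm u \<le> nrm v + nrm (u - v)" using nrm_triangle[of v "u - v"] by simp
    moreover have "nrm v \<le> nrm u + nrm (u - v)"
      using nrm_triangle[of u "v - u"] by (simp add: nrm_minus_commute)
    ultimately show "dist (nrm u) (nrm v) \<le> C * dist u v"
      using nrm_le_norm[of "u - v"] by (simp add: dist_norm C_def)
  qed (fact \<open>C \<ge> 0\<close>)
  then show "continuous_on UNIV nrm" by (rule lipschitz_on_continuous_on)
qed auto

text \<open>A continuous positive function has a positive minimum on the compact unit sphere. This
  makes the sets under the suprema of \<open>dual_norm\<close> and \<open>op_norm\<close> bounded;
  for an unbounded set the real \<open>Sup\<close> would say nothing.\<close>

lemma norm_le_nrm: obtains C where "0 < C" "\<And>u. norm u \<le> C * nrm u"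
proof -
  have "\<exists>m>0. \<forall>u\<in>sphere 0 1. m \<le> nrm u"
  proof (cases "sphere (0::'a) 1 = {}")
    case False
    have "compact (sphere (0::'a) 1)" by simp
    then obtain u0 where u0: "u0 \<in> sphere 0 1" "\<forall>u\<in>sphere 0 1. nrm u0 \<le> nrm u"
      using continuous_attains_inf[OF _ False continuous_on_nrm] by blast
    then have "u0 \<noteq> 0" by auto
    then show ?thesis using u0 nrm_pos by blast
  qed (auto intro: exI[of _ 1])
  then obtain m where m: "m > 0" "\<And>u. norm u = 1 \<Longrightarrow> m \<le> nrm u" by auto
  have "norm u \<le> (1/m) * nrm u" for u
  proof (cases "u = 0")
    case False
    then have "m \<le> nrm ((1 / norm u) *\<^sub>R u)" by (intro m) simp
    then show ?thesis using False m(1) by (simp add: field_simps)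
  qed simp
  then show ?thesis using that[of "1/m"] m(1) by simp
qed

section \<open>Dual norm, operator norm and polarization\<close>

lemma dual_norm_ge: "w \<bullet> u \<le> dual_norm nrm w * nrm u"
proof (cases "u = 0")
  case False
  obtain C where C: "0 < C" "\<And>u. norm u \<le> C * nrm u" using norm_le_nrm by blast
  have bdd: "bdd_above {w \<bullet> u |u. nrm u \<le> 1}"
  proof (rule bdd_aboveI)
    fix t assume "t \<in> {w \<bullet> u |u. nrm u \<le> 1}"
    then obtain u where u: "t = w \<bullet> u" "nrm u \<le> 1" by blast
    have "norm u \<le> C" using C(2)[of u] mult_left_mono[OF u(2), of C] C(1) by linarith
    then show "t \<le> norm w * C"
      using norm_cauchy_schwarz[of w u] mult_left_mono[of "norm u" C "norm w"] u(1) by simp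
  qed
  have "w \<bullet> ((1 / nrm u) *\<^sub>R u) \<le> dual_norm nrm w"
    unfolding dual_norm_def
    by (rule cSup_upper[OF _ bdd]) (use False nrm_pos[OF False] in \<open>auto intro!: exI[of _ "(1 / nrm u) *\<^sub>R u"]\<close>)
  then show ?thesis using nrm_pos[OF False] by (simp add: field_simps)
qed simp

lemma dual_norm_le:
  assumes "\<And>u. w \<bullet> u \<le> M * nrm u" "0 \<le> M"
  shows "dual_norm nrm w \<le> M"
  unfolding dual_norm_def
proof (rule cSup_least)
  have "nrm 0 \<le> 1" by simp
  then show "{w \<bullet> u |u. nrm u \<le> 1} \<noteq> {}" by blast
  fix t assume "t \<in> {w \<bullet> u |u. nrm u \<le> 1}"
  then obtain u where u: "t = w \<bullet> u" "nrm u \<le> 1" by blast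
  then show "t \<le> M" using assms(1)[of u] mult_left_mono[OF u(2) assms(2)] by simp
qed

lemma dual_norm_pos:
  assumes "w \<noteq> 0"
  shows "0 < dual_norm nrm w"
proof -
  have "0 < w \<bullet> w" using assms by simp
  also have "\<dots> \<le> dual_norm nrm w * nrm w" by (rule dual_norm_ge)
  finally show ?thesis using nrm_nonneg[of w] by (simp add: zero_less_mult_iff)
qed

lemma dual_norm_nonneg: "0 \<le> dual_norm nrm w"
proof (cases "w = 0")
  case True
  have "{w \<bullet> u |u. nrm u \<le> 1} = {0}"
  proof
    show "{0} \<subseteq> {w \<bullet> u |u. nrm u \<le> 1}"
      using nrm_zero by (auto intro!: exI[of _ 0])
  qed (auto simp: True)
  then show ?thesis by (simp add: dual_norm_def)
next
  case False
  then show ?thesis using dual_norm_pos[of w] by simp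
qed

lemma op_norm_ge:
  assumes "bounded_linear B"
  shows "\<bar>B u \<bullet> u\<bar> \<le> op_norm nrm B * (nrm u)\<^sup>2"
proof (cases "u = 0")
  case False
  interpret B: bounded_linear B by fact
  obtain C where C: "0 < C" "\<And>u. norm u \<le> C * nrm u" using norm_le_nrm by blast
  obtain K where K: "\<And>u. norm (B u) \<le> norm u * K" "0 < K" using B.pos_bounded by blast
  have bdd: "bdd_above {\<bar>B u \<bullet> u\<bar> |u. nrm u \<le> 1}"
  proof (rule bdd_aboveI)
    fix t assume "t \<in> {\<bar>B u \<bullet> u\<bar> |u. nrm u \<le> 1}"
    then obtain u where u: "t = \<bar>B u \<bullet> u\<bar>" "nrm u \<le> 1" by blast
    have n: "norm u \<le> C" using C(2)[of u] mult_left_mono[OF u(2), of C] C(1) by linarith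
    have "t \<le> norm (B u) * norm u" using u(1) Cauchy_Schwarz_ineq2 by simp
    also have "\<dots> \<le> (C * K) * C"
      using K(2) n C(1) order_trans[OF K(1)[of u] mult_right_mono[OF n, of K]]
      by (intro mult_mono) auto
    finally show "t \<le> C * K * C" .
  qed
  have "\<bar>B ((1 / nrm u) *\<^sub>R u) \<bullet> ((1 / nrm u) *\<^sub>R u)\<bar> \<le> op_norm nrm B"
    unfolding op_norm_def
    by (rule cSup_upper[OF _ bdd])
      (use False nrm_pos[OF False] in \<open>auto intro!: exI[of _ "(1 / nrm u) *\<^sub>R u"]\<close>)
  then have "\<bar>B u \<bullet> u\<bar> / (nrm u)\<^sup>2 \<le> op_norm nrm B"
    using nrm_pos[OF False] by (simp add: B.scaleR abs_mult power2_eq_square)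
  then show ?thesis using False by (simp add: divide_le_eq)
qed simp

text \<open>Polarization on unit vectors: \<open>p + q\<close> and \<open>p - q\<close> have norm at
  most 2, so each quadratic form is at most \<open>4 * M\<close> and
  \<open>4 * (B p \<bullet> q)\<close> is at most \<open>8 * M\<close>. A general norm has no
  parallelogram law to sharpen this, which is where the factor 2 comes from.\<close>

lemma bilinear_form_bound_by_quadratic:
  assumes "linear B" and sym: "\<And>u v. B u \<bullet> v = B v \<bullet> u"
    and quad: "\<And>u. \<bar>B u \<bullet> u\<bar> \<le> M * (nrm u)\<^sup>2" and "0 \<le> M"
  shows "B u \<bullet> v \<le> 2 * M * nrm u * nrm v"
proof (cases "u = 0 \<or> v = 0")
  case True
  then show ?thesis using assms(1) by (auto simp: linear_0)
next
  case False
  define p where "p = (1 / nrm u) *\<^sub>R u"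
  define q where "q = (1 / nrm v) *\<^sub>R v"
  have pos: "nrm u > 0" "nrm v > 0" using False by (auto intro: nrm_pos)
  have pq: "nrm p = 1" "nrm q = 1" using pos by (auto simp: p_def q_def)
  have "nrm (p + q) \<le> 2" "nrm (p - q) \<le> 2"
    using nrm_triangle[of p q] nrm_triangle_diff[of p q] pq by auto
  then have "(nrm (p + q))\<^sup>2 \<le> 2\<^sup>2" "(nrm (p - q))\<^sup>2 \<le> 2\<^sup>2"
    by (intro power_mono; simp)+
  then have "M * (nrm (p + q))\<^sup>2 \<le> M * 4" "M * (nrm (p - q))\<^sup>2 \<le> M * 4"
    using \<open>0 \<le> M\<close> by (auto intro: mult_left_mono)
  then have "B (p + q) \<bullet> (p + q) \<le> M * 4" "- (B (p - q) \<bullet> (p - q)) \<le> M * 4"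
    using quad[of "p + q"] quad[of "p - q"] by linarith+
  moreover have "4 * (B p \<bullet> q) = B (p + q) \<bullet> (p + q) - B (p - q) \<bullet> (p - q)"
    using sym[of p q] by (simp add: linear_add[OF assms(1)] linear_diff[OF assms(1)] algebra_simps)
  ultimately have "B p \<bullet> q \<le> 2 * M" by linarith
  then show ?thesis using pos
    by (simp add: p_def q_def linear_scale[OF assms(1)] field_simps)
qed

end

section \<open>Functions with Lipschitz Hessian\<close>

text \<open>Monotonicity of \<open>\<theta> - \<phi>\<close>. It stands in for integrating
  derivative bounds in all Taylor estimates below.\<close>

lemma increment_le_by_derivative:
  fixes \<phi> :: "real \<Rightarrow> real"
  assumes "\<And>t. t \<in> {0..1} \<Longrightarrow> (\<phi> has_real_derivative \<phi>' t) (at t)"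
    and "\<And>t. t \<in> {0..1} \<Longrightarrow> (\<theta> has_real_derivative \<theta>' t) (at t)"
    and "\<And>t. t \<in> {0..1} \<Longrightarrow> \<phi>' t \<le> \<theta>' t" and "a \<in> {0..1}"
  shows "\<phi> a - \<phi> 0 \<le> \<theta> a - \<theta> 0"
proof -
  have "\<theta> 0 - \<phi> 0 \<le> \<theta> a - \<phi> a"
  proof (rule DERIV_nonneg_imp_nondecreasing[where f = "\<lambda>t. \<theta> t - \<phi> t"])
    fix t assume "0 \<le> t" "t \<le> a"
    then have t: "t \<in> {0..1}" using assms(4) by simp
    have "((\<lambda>t. \<theta> t - \<phi> t) has_real_derivative \<theta>' t - \<phi>' t) (at t)"
      by (intro DERIV_diff assms(1,2) t)
    then show "\<exists>y. ((\<lambda>t. \<theta> t - \<phi> t) has_real_derivative y) (at t) \<and> 0 \<le> y"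
      using assms(3)[OF t] by (intro exI[of _ "\<theta>' t - \<phi>' t"]) simp
  qed (use assms(4) in simp)
  then show ?thesis by simp
qed

locale C2_function =
  fixes f :: "'a::euclidean_space \<Rightarrow> real" and gf :: "'a \<Rightarrow> 'a" and Hf :: "'a \<Rightarrow> 'a \<Rightarrow> 'a"
  assumes f_grad: "\<And>y. (f has_derivative (\<lambda>h. gf y \<bullet> h)) (at y)"
    and f_hess: "\<And>y. (gf has_derivative Hf y) (at y)"
    and hess_cont: "\<And>h. continuous_on UNIV (\<lambda>y. Hf y h)"
begin

lemma bounded_linear_hess: "bounded_linear (Hf y)"
  by (rule has_derivative_bounded_linear[OF f_hess])

lemma linear_hess: "linear (Hf y)"
  by (rule bounded_linear.linear[OF bounded_linear_hess])

lemmas hess_simps = linear_add[OF linear_hess] linear_diff[OF linear_hess]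
  linear_scale[OF linear_hess] linear_0[OF linear_hess]

lemma f_along_line: "((\<lambda>t. f (p + t *\<^sub>R h)) has_real_derivative gf (p + t *\<^sub>R h) \<bullet> h) (at t)"
proof -
  have "((\<lambda>t. p + t *\<^sub>R h) has_derivative (\<lambda>s. s *\<^sub>R h)) (at t)"
    by (auto intro!: derivative_eq_intros)
  from has_derivative_compose[OF this f_grad]
  show ?thesis by (simp add: has_field_derivative_def mult_commute_abs)
qed

lemma grad_along_line:
  "((\<lambda>t. gf (p + t *\<^sub>R h) \<bullet> v) has_real_derivative Hf (p + t *\<^sub>R h) h \<bullet> v) (at t)"
proof -
  have "((\<lambda>t. p + t *\<^sub>R h) has_derivative (\<lambda>s. s *\<^sub>R h)) (at t)"
    by (auto intro!: derivative_eq_intros)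
  from has_derivative_inner_left[OF has_derivative_compose[OF this f_hess], of v]
  show ?thesis by (simp add: has_field_derivative_def mult_commute_abs hess_simps)
qed

lemma continuous_grad: "continuous_on UNIV gf"
  by (intro continuous_at_imp_continuous_on ballI has_derivative_continuous[OF f_hess])

text \<open>The mean value theorem is applied twice, first in direction \<open>v\<close>, then in
  direction \<open>u\<close>.\<close>

lemma second_difference:
  assumes "s > 0"
  obtains \<alpha> \<beta> where "0 < \<alpha>" "\<alpha> < s" "0 < \<beta>" "\<beta> < s"
    "f (p + s *\<^sub>R u + s *\<^sub>R v) - f (p + s *\<^sub>R u) - f (p + s *\<^sub>R v) + f p
       = s\<^sup>2 * (Hf (p + \<alpha> *\<^sub>R u + \<beta> *\<^sub>R v) u \<bullet> v)"
proof -
  let ?\<phi> = "\<lambda>t. f ((p + s *\<^sub>R u) + t *\<^sub>R v) - f (p + t *\<^sub>R v)"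
  have "\<And>t. (?\<phi> has_real_derivative gf ((p + s *\<^sub>R u) + t *\<^sub>R v) \<bullet> v - gf (p + t *\<^sub>R v) \<bullet> v) (at t)"
    by (intro derivative_intros f_along_line)
  from MVT2[OF assms this] obtain \<beta> where b: "0 < \<beta>" "\<beta> < s"
    "?\<phi> s - ?\<phi> 0 = s * (gf ((p + s *\<^sub>R u) + \<beta> *\<^sub>R v) \<bullet> v - gf (p + \<beta> *\<^sub>R v) \<bullet> v)" by auto
  have "\<And>t. ((\<lambda>t. gf ((p + \<beta> *\<^sub>R v) + t *\<^sub>R u) \<bullet> v) has_real_derivative
      Hf ((p + \<beta> *\<^sub>R v) + t *\<^sub>R u) u \<bullet> v) (at t)"
    by (rule grad_along_line)
  from MVT2[OF assms this] obtain \<alpha> where a: "0 < \<alpha>" "\<alpha> < s"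
    "gf ((p + \<beta> *\<^sub>R v) + s *\<^sub>R u) \<bullet> v - gf (p + \<beta> *\<^sub>R v) \<bullet> v
       = s * (Hf ((p + \<beta> *\<^sub>R v) + \<alpha> *\<^sub>R u) u \<bullet> v)" by auto
  show ?thesis
    by (rule that[of \<alpha> \<beta>]) (use a b in \<open>auto simp: algebra_simps power2_eq_square\<close>)
qed

text \<open>Schwarz's theorem: the second difference does not change when \<open>u\<close> and
  \<open>v\<close> are exchanged, so its two mean value forms agree for every step
  \<open>s n\<close>, and continuity of the Hessian carries the equality to the limit.\<close>

lemma hess_sym: "Hf p u \<bullet> v = Hf p v \<bullet> u"
proof -
  define s where "s = (\<lambda>n. 1 / real (Suc n))"
  have s_pos: "s n > 0" for n by (simp add: s_def)
  have s_lim: "s \<longlonglongrightarrow> 0" unfolding s_def by (rule LIMSEQ_Suc[OF lim_1_over_n])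
  have ex: "\<exists>\<alpha> \<beta>. 0 < \<alpha> \<and> \<alpha> < s n \<and> 0 < \<beta> \<and> \<beta> < s n \<and>
    f (p + s n *\<^sub>R u + s n *\<^sub>R v) - f (p + s n *\<^sub>R u) - f (p + s n *\<^sub>R v) + f p
       = (s n)\<^sup>2 * (Hf (p + \<alpha> *\<^sub>R u + \<beta> *\<^sub>R v) u \<bullet> v)" for n u v
    using second_difference[OF s_pos[of n]] by metis
  obtain a b where ab: "\<And>n. 0 < a n \<and> a n < s n \<and> 0 < b n \<and> b n < s n \<and>
    f (p + s n *\<^sub>R u + s n *\<^sub>R v) - f (p + s n *\<^sub>R u) - f (p + s n *\<^sub>R v) + f p
       = (s n)\<^sup>2 * (Hf (p + a n *\<^sub>R u + b n *\<^sub>R v) u \<bullet> v)"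
    using ex[of _ u v] by metis
  obtain a' b' where ab': "\<And>n. 0 < a' n \<and> a' n < s n \<and> 0 < b' n \<and> b' n < s n \<and>
    f (p + s n *\<^sub>R v + s n *\<^sub>R u) - f (p + s n *\<^sub>R v) - f (p + s n *\<^sub>R u) + f p
       = (s n)\<^sup>2 * (Hf (p + a' n *\<^sub>R v + b' n *\<^sub>R u) v \<bullet> u)"
    using ex[of _ v u] by metis
  have null: "c \<longlonglongrightarrow> 0" if "\<And>n. 0 < c n \<and> c n < s n" for c
    by (rule tendsto_sandwich[OF _ _ tendsto_const s_lim]) (use that in \<open>auto simp: less_imp_le\<close>)
  have lim: "(\<lambda>n. Hf (p + c n *\<^sub>R u' + c' n *\<^sub>R v') u' \<bullet> v') \<longlonglongrightarrow> Hf p u' \<bullet> v'"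
    if "c \<longlonglongrightarrow> 0" "c' \<longlonglongrightarrow> 0" for c c' u' v'
  proof -
    have "(\<lambda>n. p + c n *\<^sub>R u' + c' n *\<^sub>R v') \<longlonglongrightarrow> p + 0 *\<^sub>R u' + 0 *\<^sub>R v'"
      using that by (intro tendsto_intros)
    then have "(\<lambda>n. p + c n *\<^sub>R u' + c' n *\<^sub>R v') \<longlonglongrightarrow> p" by simp
    then show ?thesis
      by (intro tendsto_intros continuous_on_tendsto_compose[OF hess_cont]) auto
  qed
  have "Hf (p + a n *\<^sub>R u + b n *\<^sub>R v) u \<bullet> v = Hf (p + a' n *\<^sub>R v + b' n *\<^sub>R u) v \<bullet> u" for n
  proof -
    have "(s n)\<^sup>2 * (Hf (p + a n *\<^sub>R u + b n *\<^sub>R v) u \<bullet> v)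
        = (s n)\<^sup>2 * (Hf (p + a' n *\<^sub>R v + b' n *\<^sub>R u) v \<bullet> u)"
      using ab[of n] ab'[of n] by (simp add: algebra_simps)
    then show ?thesis using s_pos[of n] by simp
  qed
  moreover have "(\<lambda>n. Hf (p + a n *\<^sub>R u + b n *\<^sub>R v) u \<bullet> v) \<longlonglongrightarrow> Hf p u \<bullet> v"
    using ab by (intro lim null) auto
  moreover have "(\<lambda>n. Hf (p + a' n *\<^sub>R v + b' n *\<^sub>R u) v \<bullet> u) \<longlonglongrightarrow> Hf p v \<bullet> u"
    using ab' by (intro lim null) auto
  ultimately show ?thesis by (auto intro: LIMSEQ_unique)
qed

end

text \<open>Every first-order condition below is extracted this way: a chord inequality from
  convexity or minimality is divided by \<open>t\<close>, and \<open>t\<close> tends to 0 from the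
  right.\<close>

lemma right_deriv_le:
  fixes \<phi> :: "real \<Rightarrow> real"
  assumes "(\<phi> has_real_derivative l) (at 0)" and "0 < \<eta>"
    and "\<And>t. 0 < t \<Longrightarrow> t \<le> \<eta> \<Longrightarrow> \<phi> t - \<phi> 0 \<le> C * t"
  shows "l \<le> C"
proof (rule tendsto_upperbound)
  show "((\<lambda>t. (\<phi> t - \<phi> 0) / t) \<longlongrightarrow> l) (at_right 0)"
    using assms(1) unfolding DERIV_def by (auto intro: tendsto_within_subset)
  show "eventually (\<lambda>t. (\<phi> t - \<phi> 0) / t \<le> C) (at_right 0)"
    unfolding eventually_at_right_field
    using assms(2,3) by (intro exI[of _ \<eta>]) (auto simp: divide_le_eq)
qed simp

lemma has_gradient_along_line:
  assumes "(d has_derivative (\<lambda>h. gd \<bullet> h)) (at p)"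
  shows "((\<lambda>t. d (p + t *\<^sub>R h)) has_real_derivative gd \<bullet> h) (at 0)"
proof -
  have "((\<lambda>t. p + t *\<^sub>R h) has_derivative (\<lambda>s. s *\<^sub>R h)) (at 0)"
    by (auto intro!: derivative_eq_intros)
  from has_derivative_compose[OF this, of d "\<lambda>h. gd \<bullet> h"] assms
  show ?thesis by (simp add: has_field_derivative_def mult_commute_abs)
qed

section \<open>Taylor estimates for a convex function with Lipschitz Hessian\<close>

locale hess_lipschitz = norm_on nrm + C2_function f gf Hf
  for nrm :: "'a::euclidean_space \<Rightarrow> real" and f gf Hf +
  fixes Q :: "'a set" and L :: real
  assumes Q_convex: "convex Q" and f_convex: "convex_on UNIV f" and L_pos: "0 < L"
    and hess_lip: "\<And>y z. y \<in> Q \<Longrightarrow> z \<in> Q \<Longrightarrow>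
                     op_norm nrm (\<lambda>h. Hf y h - Hf z h) \<le> L * nrm (y - z)"
begin

lemma above_tangent: "f p + gf p \<bullet> (y - p) \<le> f y"
proof -
  have "gf p \<bullet> (y - p) \<le> f y - f p"
  proof (rule right_deriv_le[OF has_gradient_along_line[OF f_grad] zero_less_one])
    fix t :: real assume t: "0 < t" "t \<le> 1"
    have "p + t *\<^sub>R (y - p) = (1 - t) *\<^sub>R p + t *\<^sub>R y" by (simp add: algebra_simps)
    then have "f (p + t *\<^sub>R (y - p)) \<le> (1 - t) * f p + t * f y"
      using convex_onD[OF f_convex, of t p y] t by simp
    then show "f (p + t *\<^sub>R (y - p)) - f (p + 0 *\<^sub>R (y - p)) \<le> (f y - f p) * t"
      by (simp add: algebra_simps)
  qed
  then show ?thesis by simp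
qed

text \<open>Adding two tangent inequalities shows that the gradient is monotone along
  \<open>h\<close>, so its derivative there is nonnegative.\<close>

lemma hess_psd: "0 \<le> Hf p h \<bullet> h"
proof -
  have "((\<lambda>t. - (gf (p + t *\<^sub>R h) \<bullet> h)) has_real_derivative - (Hf (p + 0 *\<^sub>R h) h \<bullet> h)) (at 0)"
    by (intro derivative_intros grad_along_line)
  then have "- (Hf (p + 0 *\<^sub>R h) h \<bullet> h) \<le> 0"
  proof (rule right_deriv_le[OF _ zero_less_one])
    fix t :: real assume t: "0 < t"
    have "t * (gf p \<bullet> h) \<le> t * (gf (p + t *\<^sub>R h) \<bullet> h)"
      using above_tangent[of p "p + t *\<^sub>R h"] above_tangent[of "p + t *\<^sub>R h" p] by simp
    then show "- (gf (p + t *\<^sub>R h) \<bullet> h) - - (gf (p + 0 *\<^sub>R h) \<bullet> h) \<le> 0 * t"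
      using t by simp
  qed
  then show ?thesis by simp
qed

lemma hess_diff_quad:
  assumes "p \<in> Q" "q \<in> Q"
  shows "\<bar>(Hf p u - Hf q u) \<bullet> u\<bar> \<le> L * nrm (p - q) * (nrm u)\<^sup>2"
proof -
  have "\<bar>(Hf p u - Hf q u) \<bullet> u\<bar> \<le> op_norm nrm (\<lambda>h. Hf p h - Hf q h) * (nrm u)\<^sup>2"
    using op_norm_ge[OF bounded_linear_sub[OF bounded_linear_hess bounded_linear_hess]] .
  also have "\<dots> \<le> L * nrm (p - q) * (nrm u)\<^sup>2"
    using hess_lip[OF assms] by (intro mult_right_mono) auto
  finally show ?thesis .
qed

lemma hess_diff_bilinear:
  assumes "p \<in> Q" "q \<in> Q"
  shows "(Hf p u - Hf q u) \<bullet> v \<le> 2 * (L * nrm (p - q)) * nrm u * nrm v"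
proof (rule bilinear_form_bound_by_quadratic[where B = "\<lambda>u. Hf p u - Hf q u"])
  show "linear (\<lambda>u. Hf p u - Hf q u)"
    using linear_compose_sub[OF linear_hess linear_hess] .
  show "(Hf p u - Hf q u) \<bullet> v = (Hf p v - Hf q v) \<bullet> u" for u v
    using hess_sym[of p u v] hess_sym[of q u v] by (simp add: inner_diff_left)
qed (use hess_diff_quad[OF assms] L_pos in auto)

lemma segment_mem:
  assumes "p \<in> Q" "p + h \<in> Q" "t \<in> {0..1}"
  shows "p + t *\<^sub>R h \<in> Q"
proof -
  have "p + t *\<^sub>R h = (1 - t) *\<^sub>R p + t *\<^sub>R (p + h)" by (simp add: algebra_simps)
  then show ?thesis using convexD_alt[OF Q_convex assms(1,2), of t] assms(3) by simp
qed

text \<open>The direction \<open>u\<close> is arbitrary, so the polarized bound is needed;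
  integrating its rate \<open>2 * L * t\<close> over the unit interval leaves the constant
  \<open>L\<close>.\<close>

lemma grad_residual_le:
  assumes "p \<in> Q" "p + h \<in> Q"
  shows "(gf (p + h) - gf p - Hf p h) \<bullet> u \<le> L * (nrm h)\<^sup>2 * nrm u"
proof -
  let ?\<phi> = "\<lambda>t. gf (p + t *\<^sub>R h) \<bullet> u - t * (Hf p h \<bullet> u)"
  let ?\<theta> = "\<lambda>t. L * (nrm h)\<^sup>2 * nrm u * t\<^sup>2"
  have "?\<phi> 1 - ?\<phi> 0 \<le> ?\<theta> 1 - ?\<theta> 0"
  proof (rule increment_le_by_derivative)
    fix t :: real assume t: "t \<in> {0..1}"
    show "(?\<phi> has_real_derivative Hf (p + t *\<^sub>R h) h \<bullet> u - 1 * (Hf p h \<bullet> u)) (at t)"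
      by (auto intro!: derivative_eq_intros grad_along_line)
    show "(?\<theta> has_real_derivative 2 * (L * (nrm h)\<^sup>2 * nrm u) * t) (at t)"
      by (auto intro!: derivative_eq_intros)
    show "Hf (p + t *\<^sub>R h) h \<bullet> u - 1 * (Hf p h \<bullet> u) \<le> 2 * (L * (nrm h)\<^sup>2 * nrm u) * t"
      using hess_diff_bilinear[OF segment_mem[OF assms t] assms(1), of h u] t
      by (simp add: inner_diff_left power2_eq_square algebra_simps)
  qed simp
  then show ?thesis by (simp add: inner_diff_left)
qed

text \<open>Both arguments of the Hessian form are \<open>h\<close>, so the quadratic bound suffices
  and no factor is lost. Integrating \<open>t\<close> twice gives the 1/6.\<close>

lemma cubic_upper_bound:
  assumes "p \<in> Q" "p + h \<in> Q"
  shows "f (p + h) \<le> f p + gf p \<bullet> h + 1/2 * (Hf p h \<bullet> h) + L / 6 * (nrm h) ^ 3"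
proof -
  let ?K = "L * (nrm h) ^ 3"
  have grad: "gf (p + a *\<^sub>R h) \<bullet> h \<le> gf p \<bullet> h + a * (Hf p h \<bullet> h) + ?K / 2 * a\<^sup>2"
    if a: "a \<in> {0..1}" for a
  proof -
    let ?\<phi> = "\<lambda>t. gf (p + t *\<^sub>R h) \<bullet> h - t * (Hf p h \<bullet> h)"
    let ?\<theta> = "\<lambda>t. ?K / 2 * t\<^sup>2"
    have "?\<phi> a - ?\<phi> 0 \<le> ?\<theta> a - ?\<theta> 0"
    proof (rule increment_le_by_derivative)
      fix t :: real assume t: "t \<in> {0..1}"
      show "(?\<phi> has_real_derivative Hf (p + t *\<^sub>R h) h \<bullet> h - 1 * (Hf p h \<bullet> h)) (at t)"
        by (auto intro!: derivative_eq_intros grad_along_line)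
      show "(?\<theta> has_real_derivative ?K * t) (at t)"
        by (auto intro!: derivative_eq_intros)
      show "Hf (p + t *\<^sub>R h) h \<bullet> h - 1 * (Hf p h \<bullet> h) \<le> ?K * t"
        using hess_diff_quad[OF segment_mem[OF assms t] assms(1), of h] t
        by (simp add: inner_diff_left power2_eq_square power3_eq_cube algebra_simps)
    qed (fact a)
    then show ?thesis by simp
  qed
  let ?\<phi> = "\<lambda>t. f (p + t *\<^sub>R h)"
  let ?\<theta> = "\<lambda>t. t * (gf p \<bullet> h) + t\<^sup>2 / 2 * (Hf p h \<bullet> h) + ?K / 6 * t ^ 3"
  have "?\<phi> 1 - ?\<phi> 0 \<le> ?\<theta> 1 - ?\<theta> 0"
  proof (rule increment_le_by_derivative)
    fix t :: real
    show "(?\<phi> has_real_derivative gf (p + t *\<^sub>R h) \<bullet> h) (at t)" by (rule f_along_line)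
    show "(?\<theta> has_real_derivative gf p \<bullet> h + t * (Hf p h \<bullet> h) + ?K / 2 * t\<^sup>2) (at t)"
      by (auto intro!: derivative_eq_intros)
  qed (use grad in auto)
  then show ?thesis by simp
qed

text \<open>
  Comparing the Taylor remainders of \<open>f\<close> along \<open>h\<close> at \<open>p\<close> and at \<open>p + e u\<close> needs the Hessian
  difference only as a quadratic form in \<open>h\<close>, which avoids polarization.
\<close>
lemma grad_residual_le_translate:
  assumes Q: "p \<in> Q" "p + h \<in> Q" and "0 < \<eta>"
    and tr: "\<And>e. 0 < e \<Longrightarrow> e \<le> \<eta> \<Longrightarrow> p + e *\<^sub>R u \<in> Q \<and> p + h + e *\<^sub>R u \<in> Q"
  shows "(gf (p + h) - gf p - Hf p h) \<bullet> (- u) \<le> L / 2 * (nrm h)\<^sup>2 * nrm u"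
proof -
  \<comment> \<open>Minus the linearization error of \<open>f\<close> over the step \<open>h\<close>
    from the moved base point \<open>p + e *\<^sub>R u\<close>. Its derivative at 0 is, up to
    symmetry of the Hessian, the residual paired with \<open>- u\<close>.\<close>
  let ?\<Theta> = "\<lambda>e. - (f (p + h + e *\<^sub>R u) - f (p + e *\<^sub>R u) - gf (p + e *\<^sub>R u) \<bullet> h)"
  have "(?\<Theta> has_real_derivative - (gf (p + h + 0 *\<^sub>R u) \<bullet> u - gf (p + 0 *\<^sub>R u) \<bullet> u
           - Hf (p + 0 *\<^sub>R u) u \<bullet> h)) (at 0)"
    by (intro derivative_intros grad_along_line f_along_line)
  then have "- (gf (p + h + 0 *\<^sub>R u) \<bullet> u - gf (p + 0 *\<^sub>R u) \<bullet> u - Hf (p + 0 *\<^sub>R u) u \<bullet> h)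
      \<le> L / 2 * (nrm h)\<^sup>2 * nrm u"
  proof (rule right_deriv_le[OF _ \<open>0 < \<eta>\<close>])
    fix e assume e: "0 < e" "e \<le> \<eta>"
    define K where "K = L * (e * nrm u) * (nrm h)\<^sup>2"
    define P where "P = p + e *\<^sub>R u"
    have P: "P \<in> Q" "P + h \<in> Q" using tr[OF e] by (auto simp: P_def algebra_simps)
    have d1: "gf (p + a *\<^sub>R h) \<bullet> h - gf (P + a *\<^sub>R h) \<bullet> h
        \<le> gf p \<bullet> h - gf P \<bullet> h + K * a" if a: "a \<in> {0..1}" for a
    proof -
      let ?\<phi> = "\<lambda>t. gf (p + t *\<^sub>R h) \<bullet> h - gf (P + t *\<^sub>R h) \<bullet> h"
      have "?\<phi> a - ?\<phi> 0 \<le> K * a - K * 0"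
      proof (rule increment_le_by_derivative)
        fix t :: real assume t: "t \<in> {0..1}"
        show "(?\<phi> has_real_derivative Hf (p + t *\<^sub>R h) h \<bullet> h - Hf (P + t *\<^sub>R h) h \<bullet> h) (at t)"
          by (intro derivative_intros grad_along_line)
        show "((\<lambda>t. K * t) has_real_derivative K) (at t)"
          by (auto intro!: derivative_eq_intros)
        \<comment> \<open>The two segments are translates of each other, so the Hessians at equal
          parameters differ by at most \<open>L * e * nrm u\<close>, uniformly in
          \<open>t\<close>.\<close>
        have "(p + t *\<^sub>R h) - (P + t *\<^sub>R h) = (- e) *\<^sub>R u" by (simp add: P_def)
        then have "nrm ((p + t *\<^sub>R h) - (P + t *\<^sub>R h)) = e * nrm u" using e nrm_scaleR by simp
        then show "Hf (p + t *\<^sub>R h) h \<bullet> h - Hf (P + t *\<^sub>R h) h \<bullet> h \<le> K"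
          using hess_diff_quad[OF segment_mem[OF Q t] segment_mem[OF P t], of h]
          by (simp add: inner_diff_left K_def)
      qed (fact a)
      then show ?thesis by simp
    qed
    let ?\<phi> = "\<lambda>t. f (p + t *\<^sub>R h) - f (P + t *\<^sub>R h)"
    let ?\<theta> = "\<lambda>t. t * (gf p \<bullet> h - gf P \<bullet> h) + K / 2 * t\<^sup>2"
    have "?\<phi> 1 - ?\<phi> 0 \<le> ?\<theta> 1 - ?\<theta> 0"
    proof (rule increment_le_by_derivative)
      fix t :: real
      show "(?\<phi> has_real_derivative gf (p + t *\<^sub>R h) \<bullet> h - gf (P + t *\<^sub>R h) \<bullet> h) (at t)"
        by (intro derivative_intros f_along_line)
      show "(?\<theta> has_real_derivative gf p \<bullet> h - gf P \<bullet> h + K * t) (at t)"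
        by (auto intro!: derivative_eq_intros)
    qed (use d1 in auto)
    then show "?\<Theta> e - ?\<Theta> 0 \<le> L / 2 * (nrm h)\<^sup>2 * nrm u * e"
      by (simp add: K_def P_def algebra_simps)
  qed
  then show ?thesis using hess_sym[of p u h] by (simp add: inner_diff_left)
qed

text \<open>Translations towards \<open>z\<close> stay in \<open>Q\<close> near
  \<open>p + h\<close>. The bound is therefore proved with base points slightly inside the segment
  and passed to the limit by continuity of gradient and Hessian.\<close>

lemma grad_residual_le_inside:
  assumes Q: "p \<in> Q" "p + h \<in> Q" "z \<in> Q"
  shows "(gf (p + h) - gf p - Hf p h) \<bullet> (p + h - z) \<le> L / 2 * (nrm h)\<^sup>2 * nrm (p + h - z)"
proof -
  define u where "u = z - (p + h)"
  \<comment> \<open>\<open>p\<close> itself need not admit translations along \<open>u\<close> inside \<open>Q\<close>, but \<open>p + s h\<close> with \<open>s > 0\<close> does.\<close>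
  define s where "s = (\<lambda>n. 1 / real (Suc n))"
  have s: "0 < s n" "s n \<le> 1" for n by (auto simp: s_def)
  have s_lim: "s \<longlonglongrightarrow> 0" unfolding s_def by (rule LIMSEQ_Suc[OF lim_1_over_n])
  define q where "q = (\<lambda>n. p + s n *\<^sub>R h)"
  have "(\<lambda>n. p + s n *\<^sub>R h) \<longlonglongrightarrow> p + 0 *\<^sub>R h" using s_lim by (intro tendsto_intros)
  then have q_lim: "q \<longlonglongrightarrow> p" by (simp add: q_def)
  have le: "(gf (p + h) - gf (q n) - (1 - s n) *\<^sub>R Hf (q n) h) \<bullet> (- u) \<le> L / 2 * (nrm h)\<^sup>2 * nrm u"
    for n
  proof -
    have qh: "q n + (1 - s n) *\<^sub>R h = p + h" by (simp add: q_def algebra_simps)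
    have qQ: "q n \<in> Q" unfolding q_def by (rule segment_mem[OF Q(1,2)]) (use s in \<open>auto simp: less_imp_le\<close>)
    have tr: "q n + e *\<^sub>R u \<in> Q \<and> q n + (1 - s n) *\<^sub>R h + e *\<^sub>R u \<in> Q" if "0 < e" "e \<le> s n" for e
    proof
      \<comment> \<open>\<open>q n + e *\<^sub>R u\<close> lies on the segment from \<open>p\<close>
        to a point between \<open>p + h\<close> and \<open>z\<close>; hence the restriction
        \<open>e \<le> s n\<close>.\<close>
      have "p + h + (e / s n) *\<^sub>R u \<in> Q"
        by (rule segment_mem) (use Q that s[of n] in \<open>auto simp: u_def\<close>)
      then have "p + s n *\<^sub>R (h + (e / s n) *\<^sub>R u) \<in> Q"
        by (intro segment_mem) (use Q s[of n] in \<open>auto simp: add.assoc less_imp_le\<close>)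
      then show "q n + e *\<^sub>R u \<in> Q"
        using s(1)[of n] by (simp add: q_def algebra_simps)
      show "q n + (1 - s n) *\<^sub>R h + e *\<^sub>R u \<in> Q" unfolding qh
        by (rule segment_mem) (use Q that s[of n] in \<open>auto simp: u_def\<close>)
    qed
    have "(gf (p + h) - gf (q n) - Hf (q n) ((1 - s n) *\<^sub>R h)) \<bullet> (- u)
        \<le> L / 2 * (nrm ((1 - s n) *\<^sub>R h))\<^sup>2 * nrm u"
      using grad_residual_le_translate[OF qQ _ s(1)[of n] tr] Q(2) unfolding qh by blast
    also have "\<dots> \<le> L / 2 * (nrm h)\<^sup>2 * nrm u"
      using s[of n] L_pos
      by (intro mult_right_mono mult_left_mono power_mono) (auto simp: mult_left_le_one_le)
    finally show ?thesis by (simp add: hess_simps)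
  qed
  have "(\<lambda>n. (gf (p + h) - gf (q n) - (1 - s n) *\<^sub>R Hf (q n) h) \<bullet> (- u))
      \<longlonglongrightarrow> (gf (p + h) - gf p - (1 - 0) *\<^sub>R Hf p h) \<bullet> (- u)"
    by (intro tendsto_intros s_lim continuous_on_tendsto_compose[OF hess_cont q_lim]
        continuous_on_tendsto_compose[OF continuous_grad q_lim]) auto
  then have "(gf (p + h) - gf p - (1 - 0) *\<^sub>R Hf p h) \<bullet> (- u) \<le> L / 2 * (nrm h)\<^sup>2 * nrm u"
    by (rule LIMSEQ_le_const2) (use le in auto)
  then show ?thesis by (simp add: u_def nrm_minus_commute)
qed

end

section \<open>One step of the method\<close>

locale bregman_newton = hess_lipschitz nrm f gf Hf Q L
  for nrm :: "'a::euclidean_space \<Rightarrow> real" and f gf Hf Q L +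
  fixes \<psi> :: "'a \<Rightarrow> real" and d :: "'a \<Rightarrow> real" and gd :: "'a \<Rightarrow> 'a" and \<sigma> :: real
  assumes psi_convex: "convex_on Q \<psi>"
    and psi_closed: "closed {(y, t). y \<in> Q \<and> \<psi> y \<le> t}"
    and sigma_pos: "0 < \<sigma>"
    and d_grad: "\<And>y. (d has_derivative (\<lambda>h. gd y \<bullet> h)) (at y)"
    and d_strong: "\<And>y z. y \<in> Q \<Longrightarrow> z \<in> Q \<Longrightarrow>
                     d z \<ge> d y + gd y \<bullet> (z - y) + \<sigma> / 2 * (nrm (z - y))\<^sup>2"
    and d_lip: "\<And>y z. y \<in> Q \<Longrightarrow> z \<in> Q \<Longrightarrow> dual_norm nrm (gd y - gd z) \<le> nrm (y - z)"
begin

abbreviation F :: "'a \<Rightarrow> real" where "F \<equiv> \<lambda>y. f y + \<psi> y"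

abbreviation T :: "real \<Rightarrow> 'a \<Rightarrow> 'a" where "T \<equiv> Tmap f gf Hf d gd \<psi> Q"

section \<open>Existence of a minimizer of the model\<close>

definition smooth_model :: "real \<Rightarrow> 'a \<Rightarrow> 'a \<Rightarrow> real" where
  "smooth_model A p y = f p + gf p \<bullet> (y - p) + 1/2 * (Hf p (y - p) \<bullet> (y - p))
     + A * bregman d gd p y"

lemma model_eq: "model f gf Hf d gd \<psi> A p y = smooth_model A p y + \<psi> y"
  by (simp add: model_def smooth_model_def)

lemma smooth_model_self: "smooth_model A p p = f p"
  by (simp add: smooth_model_def bregman_def)

text \<open>Removing the gradient of \<open>f\<close> from a subgradient of \<open>F\<close> leaves
  a subgradient of \<open>\<psi>\<close>: along the segment to \<open>y\<close>, convexity bounds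
  the increment of \<open>\<psi>\<close>, and the increment of \<open>f\<close> becomes its gradient
  in the limit.\<close>

lemma psi_above_tangent:
  assumes "p \<in> Q" "y \<in> Q" "w \<in> subdiff F Q p"
  shows "\<psi> p + (w - gf p) \<bullet> (y - p) \<le> \<psi> y"
proof -
  have "- (gf p \<bullet> (y - p)) \<le> \<psi> y - \<psi> p - w \<bullet> (y - p)"
  proof (rule right_deriv_le[OF DERIV_minus[OF has_gradient_along_line[OF f_grad]] zero_less_one])
    fix t :: real assume t: "0 < t" "t \<le> 1"
    let ?y = "p + t *\<^sub>R (y - p)"
    have "?y \<in> Q" by (rule segment_mem) (use assms t in auto)
    then have "F ?y \<ge> F p + w \<bullet> (?y - p)" using assms(3) by (auto simp: subdiff_def)
    moreover have "?y = (1 - t) *\<^sub>R p + t *\<^sub>R y" by (simp add: algebra_simps)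
    then have "\<psi> ?y \<le> (1 - t) * \<psi> p + t * \<psi> y"
      using convex_onD[OF psi_convex, of t p y] t assms by simp
    ultimately show "- f ?y - - f (p + 0 *\<^sub>R (y - p)) \<le> (\<psi> y - \<psi> p - w \<bullet> (y - p)) * t"
      by (simp add: algebra_simps)
  qed
  then show ?thesis by (simp add: inner_diff_left)
qed

lemma continuous_smooth_model: "continuous_on UNIV (smooth_model A p)"
proof -
  have d: "continuous_on UNIV d"
    by (intro continuous_at_imp_continuous_on ballI has_derivative_continuous[OF d_grad])
  have "continuous_on UNIV (\<lambda>y. Hf p (y - p))"
    by (intro bounded_linear.continuous_on[OF bounded_linear_hess] continuous_intros)
  with d show ?thesis
    unfolding smooth_model_def bregman_def by (intro continuous_intros)
qed

lemma smooth_model_ge: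
  assumes "p \<in> Q" "y \<in> Q" "0 \<le> A"
  shows "f p + gf p \<bullet> (y - p) + A * \<sigma> / 2 * (nrm (y - p))\<^sup>2 \<le> smooth_model A p y"
proof -
  have "A * (\<sigma> / 2 * (nrm (y - p))\<^sup>2) \<le> A * bregman d gd p y"
    using d_strong[OF assms(1,2)] assms(3) by (intro mult_left_mono) (auto simp: bregman_def)
  then show ?thesis using hess_psd[of p "y - p"] by (simp add: smooth_model_def)
qed

text \<open>The subgradient \<open>w\<close> supplies an affine minorant of \<open>\<psi>\<close>,
  and the strong convexity of \<open>d\<close> a quadratic term that outgrows it, so the relevant
  level set is compact.\<close>

lemma model_has_minimizer:
  assumes "p \<in> Q" "w \<in> subdiff F Q p" "0 < A"
  shows "\<exists>q\<in>Q. \<forall>y\<in>Q. smooth_model A p q + \<psi> q \<le> smooth_model A p y + \<psi> y"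
proof -
  let ?m = "smooth_model A p"
  \<comment> \<open>\<open>\<psi>\<close> is only lower semicontinuous, so minimize over its closed epigraph instead.\<close>
  define S where "S = {(y, t). y \<in> Q \<and> \<psi> y \<le> t} \<inter> {z. ?m (fst z) + snd z \<le> f p + \<psi> p}"
  have cont: "continuous_on UNIV (\<lambda>z. ?m (fst z) + snd z)"
    by (intro continuous_intros continuous_on_compose2[OF continuous_smooth_model]) auto
  have "closed S" unfolding S_def
    by (intro closed_Int psi_closed closed_Collect_le cont continuous_intros)
  obtain C where C: "0 < C" "\<And>u. norm u \<le> C * nrm u" using norm_le_nrm by blast
  \<comment> \<open>On the level set \<open>A * \<sigma> / 2 * n\<^sup>2\<close> is at most
    \<open>dual_norm nrm w * n\<close>, where \<open>n = nrm (y - p)\<close>; solving for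
    \<open>n\<close> and converting to the Euclidean norm with \<open>C\<close> gives this
    radius.\<close>
  define R where "R = C * (2 * dual_norm nrm w / (A * \<sigma>))"
  have "S \<subseteq> cball p R \<times> {\<psi> p - norm (w - gf p) * R .. \<psi> p + norm (gf p) * R}"
  proof
    fix z assume z: "z \<in> S"
    obtain y t where yt: "z = (y, t)" by fastforce
    have y: "y \<in> Q" "\<psi> y \<le> t" and t: "?m y + t \<le> f p + \<psi> p"
      using z by (auto simp: S_def yt)
    let ?n = "nrm (y - p)"
    note tangent = psi_above_tangent[OF assms(1) y(1) assms(2)]
    note below = smooth_model_ge[OF assms(1) y(1), of A]
    have "A * \<sigma> / 2 * ?n\<^sup>2 \<le> w \<bullet> (p - y)"
      using tangent below y t assms(3) by (simp add: inner_diff_left inner_diff_right)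
    also have "\<dots> \<le> dual_norm nrm w * ?n"
      using dual_norm_ge[of w "p - y"] by (simp add: nrm_minus_commute)
    finally have "?n * (A * \<sigma> * ?n) \<le> ?n * (2 * dual_norm nrm w)"
      by (simp add: power2_eq_square algebra_simps)
    then have "?n \<le> 2 * dual_norm nrm w / (A * \<sigma>)"
      using assms(3) sigma_pos dual_norm_nonneg[of w] nrm_nonneg[of "y - p"]
      by (cases "?n = 0") (auto simp: field_simps)
    then have n: "norm (y - p) \<le> R"
      using C(2)[of "y - p"] C(1) unfolding R_def
      by (meson less_imp_le mult_left_mono order_trans)
    have "\<bar>(w - gf p) \<bullet> (y - p)\<bar> \<le> norm (w - gf p) * R"
      by (rule order_trans[OF Cauchy_Schwarz_ineq2 mult_left_mono[OF n]]) simp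
    moreover have "\<bar>gf p \<bullet> (y - p)\<bar> \<le> norm (gf p) * R"
      by (rule order_trans[OF Cauchy_Schwarz_ineq2 mult_left_mono[OF n]]) simp
    moreover have "0 \<le> A * \<sigma> / 2 * ?n\<^sup>2" using assms(3) sigma_pos by simp
    ultimately show "z \<in> cball p R \<times> {\<psi> p - norm (w - gf p) * R .. \<psi> p + norm (gf p) * R}"
      using n tangent below y t assms(3)
      by (auto simp: yt dist_norm norm_minus_commute)
  qed
  then have "bounded S" by (rule bounded_subset[rotated]) (intro bounded_Times bounded_cball bounded_closed_interval)
  with \<open>closed S\<close> have "compact S" by (simp add: compact_eq_bounded_closed)
  moreover have pS: "(p, \<psi> p) \<in> S" using assms(1) by (simp add: S_def smooth_model_self)
  ultimately obtain z where z: "z \<in> S" "\<And>z'. z' \<in> S \<Longrightarrow> ?m (fst z) + snd z \<le> ?m (fst z') + snd z'"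
    using continuous_attains_inf[of S "\<lambda>z. ?m (fst z) + snd z"] continuous_on_subset[OF cont]
    by blast
  have "?m (fst z) + \<psi> (fst z) \<le> ?m y + \<psi> y" if y: "y \<in> Q" for y
  proof -
    have "?m (fst z) + \<psi> (fst z) \<le> ?m (fst z) + snd z" using z(1) by (auto simp: S_def)
    also have "\<dots> \<le> ?m y + \<psi> y"
    proof (cases "?m y + \<psi> y \<le> f p + \<psi> p")
      case True
      then show ?thesis using z(2)[of "(y, \<psi> y)"] y by (simp add: S_def)
    next
      case False
      then show ?thesis using z(2)[OF pS] by (simp add: smooth_model_self)
    qed
    finally show ?thesis .
  qed
  moreover have "fst z \<in> Q" using z(1) by (auto simp: S_def)
  ultimately show ?thesis by blast
qed

text \<open>\<open>Tmap\<close> is a choice by \<open>arg_min\<close>, so it has the minimizing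
  property only because a minimizer exists.\<close>

lemma T_is_minimizer:
  assumes "p \<in> Q" "w \<in> subdiff F Q p" "0 < A"
  shows "T A p \<in> Q" and "y \<in> Q \<Longrightarrow> smooth_model A p (T A p) + \<psi> (T A p) \<le> smooth_model A p y + \<psi> y"
proof -
  obtain q where "q \<in> Q" "\<forall>y\<in>Q. smooth_model A p q + \<psi> q \<le> smooth_model A p y + \<psi> y"
    using model_has_minimizer[OF assms] by blast
  then have "is_arg_min (model f gf Hf d gd \<psi> A p) (\<lambda>y. y \<in> Q) q"
    by (simp add: is_arg_min_linorder model_eq)
  then have "is_arg_min (model f gf Hf d gd \<psi> A p) (\<lambda>y. y \<in> Q) (T A p)"
    unfolding Tmap_def arg_min_def by (rule someI)
  then show "T A p \<in> Q" "y \<in> Q \<Longrightarrow> smooth_model A p (T A p) + \<psi> (T A p) \<le> smooth_model A p y + \<psi> y"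
    by (simp_all add: is_arg_min_linorder model_eq)
qed

end

section \<open>Optimality, decrease and the new subgradient in a single step\<close>

locale bregman_newton_step = bregman_newton nrm f gf Hf Q L \<psi> d gd \<sigma>
  for nrm :: "'a::euclidean_space \<Rightarrow> real" and f gf Hf Q L \<psi> d gd \<sigma> +
  fixes p w :: 'a and A :: real
  assumes p: "p \<in> Q" and w: "w \<in> subdiff (\<lambda>y. f y + \<psi> y) Q p" and A_pos: "0 < A"
begin

definition q :: 'a where "q = T A p"
definition r :: real where "r = nrm (q - p)"
text \<open>With \<open>p\<close>, \<open>w\<close>, \<open>A\<close> in the roles of
  \<open>x j\<close>, \<open>Fp j\<close>, \<open>A j\<close>, this is
  \<open>Fp (Suc j)\<close>.\<close>

definition w' :: 'a where "w' = gf q - gf p - Hf p (q - p) - A *\<^sub>R (gd q - gd p)"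

lemma q: "q \<in> Q"
  unfolding q_def by (rule T_is_minimizer[OF p w A_pos])

lemma r_nonneg: "0 \<le> r"
  by (simp add: r_def)

text \<open>The variational inequality at the minimizer \<open>q\<close>: moving towards
  \<open>y\<close>, the one-sided slope of the smooth part cannot outweigh the chord slope of the
  convex \<open>\<psi>\<close>.\<close>

lemma optimality:
  assumes y: "y \<in> Q"
  shows "\<psi> q \<le> \<psi> y + (gf p + Hf p (q - p) + A *\<^sub>R (gd q - gd p)) \<bullet> (y - q)"
proof -
  define v where "v = y - q"
  define h where "h = q - p"
  have quad: "Hf p (q + t *\<^sub>R v - p) \<bullet> (q + t *\<^sub>R v - p)
      = Hf p h \<bullet> h + t * (2 * (Hf p h \<bullet> v)) + t\<^sup>2 * (Hf p v \<bullet> v)" for t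
  proof -
    have eq: "q + t *\<^sub>R v - p = h + t *\<^sub>R v" by (simp add: h_def)
    have "Hf p (h + t *\<^sub>R v) = Hf p h + t *\<^sub>R Hf p v" by (simp only: hess_simps)
    then show ?thesis unfolding eq
      by (simp add: hess_sym[of p v h] inner_add_left inner_add_right power2_eq_square distrib_left)
  qed
  have "((\<lambda>t. smooth_model A p (q + t *\<^sub>R v)) has_real_derivative
      gf p \<bullet> v + Hf p h \<bullet> v + A * (gd q \<bullet> v - gd p \<bullet> v)) (at 0)"
    unfolding smooth_model_def bregman_def quad
    by (auto intro!: derivative_eq_intros has_gradient_along_line[OF d_grad]
        simp: inner_diff_right inner_add_right)
  then have "- (gf p \<bullet> v + Hf p h \<bullet> v + A * (gd q \<bullet> v - gd p \<bullet> v)) \<le> \<psi> y - \<psi> q"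
  proof (rule right_deriv_le[OF DERIV_minus zero_less_one])
    fix t :: real assume t: "0 < t" "t \<le> 1"
    have "q + t *\<^sub>R v \<in> Q" by (rule segment_mem) (use q y t in \<open>auto simp: v_def\<close>)
    then have "smooth_model A p q + \<psi> q \<le> smooth_model A p (q + t *\<^sub>R v) + \<psi> (q + t *\<^sub>R v)"
      unfolding q_def by (rule T_is_minimizer[OF p w A_pos])
    moreover have "q + t *\<^sub>R v = (1 - t) *\<^sub>R q + t *\<^sub>R y" by (simp add: v_def algebra_simps)
    then have "\<psi> (q + t *\<^sub>R v) \<le> (1 - t) * \<psi> q + t * \<psi> y"
      using convex_onD[OF psi_convex, of t q y] t q y by simp
    ultimately show "- smooth_model A p (q + t *\<^sub>R v) - - smooth_model A p (q + 0 *\<^sub>R v)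
        \<le> (\<psi> y - \<psi> q) * t"
      by (simp add: algebra_simps)
  qed
  then show ?thesis by (simp add: v_def h_def inner_add_left inner_diff_left)
qed

text \<open>\<open>optimality\<close> exhibits a subgradient of \<open>\<psi>\<close> at
  \<open>q\<close>; adding the gradient of \<open>f\<close> at \<open>q\<close> yields exactly
  \<open>w'\<close>.\<close>

lemma new_subgradient: "w' \<in> subdiff F Q q"
  unfolding subdiff_def
proof (intro CollectI ballI)
  fix y assume "y \<in> Q"
  from optimality[OF this] above_tangent[of q y]
  show "F q + w' \<bullet> (y - q) \<le> F y"
    by (simp add: w'_def inner_add_left inner_diff_left)
qed

lemma d_grad_monotone: "\<sigma> * r\<^sup>2 \<le> (gd q - gd p) \<bullet> (q - p)"
  using d_strong[OF p q] d_strong[OF q p]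
  by (simp add: r_def nrm_minus_commute[of p q] inner_diff_left inner_diff_right)

lemma A_d_grad_monotone: "A * \<sigma> * r\<^sup>2 \<le> A * ((gd q - gd p) \<bullet> (q - p))"
  using mult_left_mono[OF d_grad_monotone, of A] A_pos by (simp add: mult.assoc)

text \<open>\<open>optimality\<close> tested at \<open>p\<close> and the subgradient inequality for
  \<open>w\<close> tested at \<open>q\<close> add up to
  \<open>A * \<sigma> * r\<^sup>2 \<le> - (w \<bullet> (q - p))\<close>; one factor \<open>r\<close>
  then cancels.\<close>

lemma step_length: "A * \<sigma> * r \<le> dual_norm nrm w"
proof -
  have "A * \<sigma> * r\<^sup>2 \<le> - (w \<bullet> (q - p))"
    using optimality[OF p] psi_above_tangent[OF p q w] A_d_grad_monotone hess_psd[of p "q - p"]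
    by (simp add: inner_add_left inner_diff_left inner_diff_right algebra_simps)
  also have "\<dots> \<le> dual_norm nrm w * r"
    using dual_norm_ge[of w "p - q"] by (simp add: r_def nrm_minus_commute inner_diff_right)
  finally have "r * (A * \<sigma> * r) \<le> r * dual_norm nrm w"
    by (simp add: power2_eq_square algebra_simps)
  then show ?thesis
    using r_nonneg dual_norm_nonneg[of w] by (cases "r = 0") auto
qed

text \<open>Testing \<open>optimality\<close> at \<open>p\<close> cancels the linear terms and
  leaves \<open>A * \<sigma> * r\<^sup>2\<close> plus half of a nonnegative Hessian form; the second
  assumption makes the cubic error at most half of the former.\<close>

lemma decrease:
  assumes "f q \<le> f p + gf p \<bullet> (q - p) + 1/2 * (Hf p (q - p) \<bullet> (q - p)) + M / 6 * r ^ 3"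
    and "M * r \<le> 3 * (A * \<sigma>)"
  shows "A * \<sigma> * r\<^sup>2 / 2 \<le> F p - F q"
proof -
  have "M * r * r\<^sup>2 \<le> 3 * (A * \<sigma>) * r\<^sup>2"
    using assms(2) by (intro mult_right_mono) auto
  then have "M / 6 * r ^ 3 \<le> A * \<sigma> * r\<^sup>2 / 2" by (simp add: power3_eq_cube power2_eq_square)
  then show ?thesis
    using assms(1) optimality[OF p] A_d_grad_monotone hess_psd[of p "q - p"]
    by (simp add: inner_add_left inner_diff_left inner_diff_right algebra_simps)
qed

lemma d_grad_diff_le: "- (A *\<^sub>R (gd q - gd p)) \<bullet> u \<le> A * r * nrm u"
proof -
  have "(gd q - gd p) \<bullet> (- u) \<le> r * nrm u"
    using dual_norm_ge[of "gd q - gd p" "- u"] mult_right_mono[OF d_lip[OF q p], of "nrm u"]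
    by (simp add: r_def)
  then show ?thesis using mult_left_mono[of "(gd q - gd p) \<bullet> (- u)" "r * nrm u" A] A_pos
    by (simp add: mult.assoc)
qed

lemma new_subgradient_dual_norm: "dual_norm nrm w' \<le> L * r\<^sup>2 + A * r"
proof (rule dual_norm_le)
  show "w' \<bullet> u \<le> (L * r\<^sup>2 + A * r) * nrm u" for u
    using grad_residual_le[of p "q - p" u] p q d_grad_diff_le[of u]
    by (simp add: w'_def r_def inner_diff_left algebra_simps)
qed (use L_pos A_pos r_nonneg in simp)

text \<open>The subgradient inequality pairs the residual with \<open>q - z\<close>, where
  \<open>z\<close> is in \<open>Q\<close>, so the sharper constant \<open>L / 2\<close> is
  available.\<close>

lemma new_gap:
  assumes z: "z \<in> Q"
  shows "F q - F z \<le> (L / 2 * r\<^sup>2 + A * r) * nrm (q - z)"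
proof -
  have "F q - F z \<le> w' \<bullet> (q - z)"
    using new_subgradient z by (auto simp: subdiff_def inner_diff_right)
  also have "\<dots> \<le> (L / 2 * r\<^sup>2 + A * r) * nrm (q - z)"
    using grad_residual_le_inside[of p "q - p" z] p q z d_grad_diff_le[of "q - z"]
    by (simp add: w'_def r_def inner_diff_left algebra_simps)
  finally show ?thesis .
qed

end

section \<open>Rate of convergence\<close>

text \<open>The real arithmetic of one step: \<open>a\<close>, \<open>b\<close> are consecutive
  gaps, \<open>G\<close>, \<open>G'\<close> consecutive subgradient norms, \<open>s\<close> is
  \<open>1 / \<sigma>\<close> and \<open>A\<^sub>0\<close> is \<open>A * \<sigma>\<close>. Both
  \<open>b\<close> and \<open>G'\<close> become multiples of \<open>A\<^sub>0 * r\<close>, and the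
  four resulting factors are regrouped so that the decrease can be used squared.\<close>

lemma gap_recurrence:
  fixes a b D G G' M M\<^sub>0 L s r A\<^sub>0 c\<^sub>0 :: real
  assumes M: "0 < M\<^sub>0" "M\<^sub>0 \<le> L" "M\<^sub>0 \<le> M" "M \<le> 2 * L" and "0 \<le> s" "0 \<le> r" "0 \<le> D" "0 \<le> G" "0 \<le> G'" "0 \<le> b"
    and c0: "c\<^sub>0 = s + 3 * L / (2 * M\<^sub>0)"
    and A0: "0 < A\<^sub>0" "A\<^sub>0\<^sup>2 = M / 3 * G" and r: "M * r \<le> 3 * A\<^sub>0"
    and gap: "b \<le> (L / 2 * r\<^sup>2 + s * A\<^sub>0 * r) * D"
    and G': "G' \<le> L * r\<^sup>2 + s * A\<^sub>0 * r"
    and decr: "A\<^sub>0 * r\<^sup>2 / 2 \<le> a - b"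
  shows "b ^ 3 * G' \<le> 8 * L / 3 * c\<^sub>0 ^ 4 * D ^ 3 * G * (a - b)\<^sup>2"
proof -
  define l where "l = L / M"
  have pos: "0 < M" "0 < L" using M by auto
  have l: "1 \<le> 2 * l" "0 < l" using M pos by (auto simp: l_def field_simps)
  have "L / M \<le> L / M\<^sub>0" using M pos by (intro divide_left_mono) auto
  then have c0l: "s + 3/2 * l \<le> c\<^sub>0" by (simp add: c0 l_def)
  have "1 \<le> L / M\<^sub>0" using M by simp
  then have c01: "s + 3/2 \<le> c\<^sub>0" by (simp add: c0)
  have c0_pos: "0 \<le> c\<^sub>0" using c01 \<open>0 \<le> s\<close> by linarith
  have "L * r = l * (M * r)" using pos by (simp add: l_def)
  also have "\<dots> \<le> l * (3 * A\<^sub>0)" using r l by (intro mult_left_mono) auto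
  finally have Lr: "L * r \<le> 3 * l * A\<^sub>0" by simp
  have "L * r * r \<le> 3 * l * A\<^sub>0 * r" using Lr \<open>0 \<le> r\<close> by (rule mult_right_mono)
  then have Lr2: "L * r\<^sup>2 \<le> 3 * l * (A\<^sub>0 * r)" by (simp add: power2_eq_square mult.assoc)
  have Ar: "0 \<le> A\<^sub>0 * r" using A0 \<open>0 \<le> r\<close> by simp
  have "L / 2 * r\<^sup>2 + s * A\<^sub>0 * r \<le> (s + 3/2 * l) * (A\<^sub>0 * r)"
    using Lr2 by (simp add: algebra_simps)
  also have "\<dots> \<le> c\<^sub>0 * (A\<^sub>0 * r)" using c0l Ar by (rule mult_right_mono)
  finally have "(L / 2 * r\<^sup>2 + s * A\<^sub>0 * r) * D \<le> c\<^sub>0 * (A\<^sub>0 * r) * D"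
    using \<open>0 \<le> D\<close> by (rule mult_right_mono)
  with gap have b: "b \<le> c\<^sub>0 * (A\<^sub>0 * r) * D" by linarith
  \<comment> \<open>Here \<open>M \<le> 2 * L\<close>, that is \<open>1 \<le> 2 * l\<close>, absorbs
    the factor lost by polarization in the bound on \<open>G'\<close>.\<close>
  have "s \<le> 2 * l * s" using mult_right_mono[OF l(1) \<open>0 \<le> s\<close>] by simp
  then have "s + 3 * l \<le> 2 * l * (s + 3/2)" by (simp add: algebra_simps)
  also have "\<dots> \<le> 2 * l * c\<^sub>0" using c01 l by (intro mult_left_mono) auto
  finally have "(s + 3 * l) * (A\<^sub>0 * r) \<le> 2 * l * c\<^sub>0 * (A\<^sub>0 * r)" using Ar by (rule mult_right_mono)
  then have G'': "G' \<le> 2 * l * c\<^sub>0 * (A\<^sub>0 * r)"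
    using G' Lr2 by (simp add: algebra_simps)
  have "b ^ 3 * G' \<le> (c\<^sub>0 * (A\<^sub>0 * r) * D) ^ 3 * (2 * l * c\<^sub>0 * (A\<^sub>0 * r))"
    using b G'' \<open>0 \<le> b\<close> \<open>0 \<le> G'\<close> c0_pos Ar \<open>0 \<le> D\<close>
    by (intro mult_mono power_mono) auto
  also have "\<dots> = c\<^sub>0 ^ 4 * D ^ 3 * (2 * l * A\<^sub>0\<^sup>2) * (A\<^sub>0 * r\<^sup>2)\<^sup>2"
    by (simp add: power_mult_distrib) algebra
  \<comment> \<open>The unknown \<open>M\<close> of the line search cancels between
    \<open>l = L / M\<close> and \<open>A\<^sub>0\<^sup>2 = M / 3 * G\<close>.\<close>
  also have "2 * l * A\<^sub>0\<^sup>2 = 2 * L / 3 * G" using pos by (simp add: A0(2) l_def)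
  also have "c\<^sub>0 ^ 4 * D ^ 3 * (2 * L / 3 * G) * (A\<^sub>0 * r\<^sup>2)\<^sup>2
      \<le> c\<^sub>0 ^ 4 * D ^ 3 * (2 * L / 3 * G) * (2 * (a - b))\<^sup>2"
  proof (intro mult_left_mono power_mono)
    show "0 \<le> c\<^sub>0 ^ 4 * D ^ 3 * (2 * L / 3 * G)"
      using c0_pos \<open>0 \<le> D\<close> \<open>0 \<le> G\<close> pos by simp
  qed (use decr A0 in auto)
  finally show ?thesis unfolding power_mult_distrib by (simp add: mult_ac)
qed

text \<open>With \<open>u\<close> the increment of \<open>2 * K / sqrt \<delta>\<close>, the
  recurrence implies \<open>1 \<le> (u * (a / b))\<^sup>2 * (G / G')\<close>; the claim follows by
  taking logarithms and bounding \<open>ln u\<close> by \<open>u - 1\<close>.\<close>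

lemma potential_step:
  fixes a b G G' K :: real
  assumes "0 < b" "0 < a" "b \<le> a" "0 < G" "0 < G'" "0 \<le> K"
    and rec: "b ^ 3 * G' \<le> K\<^sup>2 * G * (a - b)\<^sup>2"
  shows "1 \<le> 2 * K * (1 / sqrt b - 1 / sqrt a) + ln (a / b) + ln (G / G') / 2"
proof -
  define \<alpha> \<beta> where "\<alpha> = sqrt a" and "\<beta> = sqrt b"
  have ab: "0 < \<alpha>" "0 < \<beta>" "\<beta> \<le> \<alpha>" "a = \<alpha>\<^sup>2" "b = \<beta>\<^sup>2"
    using assms by (auto simp: \<alpha>_def \<beta>_def)
  define u where "u = 2 * K * (1 / \<beta> - 1 / \<alpha>)"
  \<comment> \<open>Positivity of the left side excludes \<open>K = 0\<close> and
    \<open>a = b\<close>, so \<open>u > 0\<close> and its logarithm is meaningful.\<close>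
  have "0 < b ^ 3 * G'" using assms by simp
  with rec have "0 < K\<^sup>2 * G * (a - b)\<^sup>2" by linarith
  then have "K \<noteq> 0" "a \<noteq> b" by auto
  then have K: "0 < K" and lt: "\<beta> < \<alpha>" using assms ab by (auto simp: less_le)
  then have u_pos: "0 < u" using ab by (auto simp: u_def field_simps)
  have "K * (a - b) = K * (\<alpha> - \<beta>) * (\<alpha> + \<beta>)"
    using ab by (simp add: power2_eq_square algebra_simps)
  also have "\<dots> \<le> K * (\<alpha> - \<beta>) * (2 * \<alpha>)"
    using K lt ab by (intro mult_left_mono) auto
  also have "\<dots> = u * a / b * \<beta> ^ 3"
    using ab by (simp add: u_def field_simps power2_eq_square power3_eq_cube)
  finally have "(K * (a - b))\<^sup>2 \<le> (u * a / b * \<beta> ^ 3)\<^sup>2"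
    using K assms by (intro power_mono) auto
  then have "G * (K * (a - b))\<^sup>2 \<le> G * (u * a / b * \<beta> ^ 3)\<^sup>2"
    using assms by (intro mult_left_mono) auto
  moreover have "(u * a / b * \<beta> ^ 3)\<^sup>2 = (u * (a / b))\<^sup>2 * b ^ 3"
    using ab(5) by (simp add: power_mult_distrib power_divide flip: power_mult)
  ultimately have "b ^ 3 * G' \<le> b ^ 3 * (G * (u * (a / b))\<^sup>2)"
    using rec by (simp add: power_mult_distrib mult_ac)
  then have "G' \<le> G * (u * (a / b))\<^sup>2" using assms by simp
  then have "1 \<le> (u * (a / b))\<^sup>2 * (G / G')" using assms by (simp add: field_simps)
  then have "ln 1 \<le> ln ((u * (a / b))\<^sup>2 * (G / G'))" using assms u_pos by (intro ln_mono) auto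
  also have "\<dots> = 2 * (ln u + ln (a / b)) + ln (G / G')"
  proof -
    have "ln ((u * (a / b))\<^sup>2 * (G / G')) = ln ((u * (a / b))\<^sup>2) + ln (G / G')"
      using assms u_pos by (intro ln_mult_pos) auto
    also have "ln ((u * (a / b))\<^sup>2) = 2 * ln (u * (a / b))"
      using assms u_pos by (subst ln_realpow) auto
    also have "ln (u * (a / b)) = ln u + ln (a / b)"
      using assms u_pos by (intro ln_mult_pos) auto
    finally show ?thesis .
  qed
  finally have "0 \<le> ln u + ln (a / b) + ln (G / G') / 2" by simp
  moreover have "1 + ln u \<le> u" using ln_le_minus_one[OF u_pos] by simp
  ultimately show ?thesis by (simp add: u_def \<alpha>_def \<beta>_def)
qed

lemma potential_telescoped:
  fixes \<delta> G :: "nat \<Rightarrow> real"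
  assumes pos: "\<And>j. j \<le> k \<Longrightarrow> 0 < \<delta> j" "\<And>j. j \<le> k \<Longrightarrow> 0 < G j"
    and mono: "\<And>j. j < k \<Longrightarrow> \<delta> (Suc j) \<le> \<delta> j" and "0 \<le> K"
    and rec: "\<And>j. j < k \<Longrightarrow> \<delta> (Suc j) ^ 3 * G (Suc j) \<le> K\<^sup>2 * G j * (\<delta> j - \<delta> (Suc j))\<^sup>2"
  shows "real k \<le> 2 * K * (1 / sqrt (\<delta> k) - 1 / sqrt (\<delta> 0)) + ln (\<delta> 0 / \<delta> k) + ln (G 0 / G k) / 2"
proof -
  have "n \<le> k \<Longrightarrow> real n \<le> 2 * K * (1 / sqrt (\<delta> n) - 1 / sqrt (\<delta> 0)) + ln (\<delta> 0 / \<delta> n) + ln (G 0 / G n) / 2"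
    for n
  proof (induction n)
    case 0
    then show ?case using pos[of 0] by simp
  next
    case (Suc n)
    have p: "0 < \<delta> 0" "0 < \<delta> n" "0 < \<delta> (Suc n)" "0 < G 0" "0 < G n" "0 < G (Suc n)"
      using pos Suc.prems by auto
    have "1 \<le> 2 * K * (1 / sqrt (\<delta> (Suc n)) - 1 / sqrt (\<delta> n)) + ln (\<delta> n / \<delta> (Suc n))
        + ln (G n / G (Suc n)) / 2"
      using Suc.prems p mono[of n] rec[of n] \<open>0 \<le> K\<close> by (intro potential_step) auto
    moreover have "real n \<le> 2 * K * (1 / sqrt (\<delta> n) - 1 / sqrt (\<delta> 0)) + ln (\<delta> 0 / \<delta> n) + ln (G 0 / G n) / 2"
      using Suc by simp
    ultimately show ?case using p by (simp add: ln_div algebra_simps diff_divide_distrib)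
  qed
  then show ?thesis by simp
qed

section \<open>Line search, invariants and the iteration bound\<close>

theorem theorem7:
  fixes nrm :: "'a::euclidean_space \<Rightarrow> real"
    and f :: "'a \<Rightarrow> real" and gf :: "'a \<Rightarrow> 'a" and Hf :: "'a \<Rightarrow> 'a \<Rightarrow> 'a"
    and \<psi> :: "'a \<Rightarrow> real" and Q :: "'a set"
    and d :: "'a \<Rightarrow> real" and gd :: "'a \<Rightarrow> 'a"
    and L2 \<sigma> \<epsilon> :: real
    and x :: "nat \<Rightarrow> 'a" and Fp :: "nat \<Rightarrow> 'a" and H :: "nat \<Rightarrow> real"
    and i :: "nat \<Rightarrow> nat" and A :: "nat \<Rightarrow> real"
    and xs :: 'a and k :: nat
  defines "F \<equiv> \<lambda>y. f y + \<psi> y"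
    and "T \<equiv> Tmap f gf Hf d gd \<psi> Q"
    and "g \<equiv> \<lambda>j. dual_norm nrm (Fp j)"
  assumes norm: "is_norm nrm"
    \<comment> \<open>psi closed convex with domain Q\<close>
    and Q_convex: "convex Q" and psi_convex: "convex_on Q \<psi>"
    and psi_closed: "closed {(y, t). y \<in> Q \<and> \<psi> y \<le> t}"
    \<comment> \<open>f convex, twice continuously differentiable, Lipschitz Hessian on Q\<close>
    and f_convex: "convex_on UNIV f"
    and f_grad: "\<And>y. (f has_derivative (\<lambda>h. gf y \<bullet> h)) (at y)"
    and f_hess: "\<And>y. (gf has_derivative Hf y) (at y)"
    and hess_cont: "\<And>h. continuous_on UNIV (\<lambda>y. Hf y h)"
    and L2_pos: "L2 > 0"
    and hess_lip: "\<And>y z. y \<in> Q \<Longrightarrow> z \<in> Q \<Longrightarrow>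
                      op_norm nrm (\<lambda>h. Hf y h - Hf z h) \<le> L2 * nrm (y - z)"
    \<comment> \<open>scaling function d\<close>
    and sigma: "0 < \<sigma>" "\<sigma> \<le> 1"
    and d_grad: "\<And>y. (d has_derivative (\<lambda>h. gd y \<bullet> h)) (at y)"
    and d_strong: "\<And>y z. y \<in> Q \<Longrightarrow> z \<in> Q \<Longrightarrow>
                      d z \<ge> d y + gd y \<bullet> (z - y) + \<sigma> / 2 * (nrm (z - y))\<^sup>2"
    and d_lip: "\<And>y z. y \<in> Q \<Longrightarrow> z \<in> Q \<Longrightarrow> dual_norm nrm (gd y - gd z) \<le> nrm (y - z)"
    \<comment> \<open>initialization\<close>
    and H0: "0 < H 0" "H 0 \<le> L2"
    and x0: "x 0 \<in> Q"
    and Fp0: "Fp 0 \<in> subdiff F Q (x 0)"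
    \<comment> \<open>the iterations\<close>
    and i_def: "\<And>j. i j = (LEAST m. let Hh = 2 ^ m * H j;
                                       y = T (1 / \<sigma> * sqrt (Hh / 3 * g j)) (x j)
                                   in f y \<le> f (x j) + gf (x j) \<bullet> (y - x j)
                                            + 1/2 * (Hf (x j) (y - x j) \<bullet> (y - x j))
                                            + Hh / 6 * (nrm (y - x j)) ^ 3)"
    and A_def: "\<And>j. A j = 1 / \<sigma> * sqrt (2 ^ i j / 3 * H j * g j)"
    and x_step: "\<And>j. x (Suc j) = T (A j) (x j)"
    and H_step: "\<And>j. H (Suc j) = max (H 0) (2 powr (real (i j) - 1) * H j)"
    and Fp_step: "\<And>j. Fp (Suc j) = gf (x (Suc j)) - gf (x j) - Hf (x j) (x (Suc j) - x j)
                                    - A j *\<^sub>R (gd (x (Suc j)) - gd (x j))"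
    \<comment> \<open>T_A is only defined for A > 0: the method runs with nonzero F'_j up to step k\<close>
    and running: "\<And>j. j < k \<Longrightarrow> Fp j \<noteq> 0"
    \<comment> \<open>minimizer, bounded level set, accuracy not reached at step k\<close>
    and xs_Q: "xs \<in> Q" and xs_min: "\<And>y. y \<in> Q \<Longrightarrow> F xs \<le> F y"
    and D_fin: "bdd_above {nrm (y - xs) | y. y \<in> Q \<and> F y \<le> F (x 0)}"
    and eps: "\<epsilon> > 0"
    and gap: "F (x k) - F xs \<ge> \<epsilon>"
  shows "let D = Sup {nrm (y - xs) | y. y \<in> Q \<and> F y \<le> F (x 0)};
             c0 = 1 / \<sigma> + 3 * L2 / (2 * H 0)
         in real k \<le> 4 * c0\<^sup>2 * sqrt (2 * L2 * D ^ 3 / (3 * \<epsilon>))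
                   + ln ((F (x 0) - F xs) * sqrt (dual_norm nrm (Fp 0)) * sqrt D / \<epsilon> powr (3/2))"
proof -
  define D where "D = Sup {nrm (y - xs) |y. y \<in> Q \<and> F y \<le> F (x 0)}"
  define c0 where "c0 = 1 / \<sigma> + 3 * L2 / (2 * H 0)"
  define \<delta> where "\<delta> = (\<lambda>j. F (x j) - F xs)"
  interpret newton: bregman_newton nrm f gf Hf Q L2 \<psi> d gd \<sigma>
    by unfold_locales (fact assms)+
  have F_eq: "F = (\<lambda>y. f y + \<psi> y)" by (simp add: F_def)
  have D_ge: "nrm (y - xs) \<le> D" if "y \<in> Q" "F y \<le> F (x 0)" for y
    unfolding D_def by (rule cSup_upper[OF _ D_fin]) (use that in blast)
  have D_nonneg: "0 \<le> D" using D_ge[OF x0] newton.nrm_nonneg[of "x 0 - xs"] by linarith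
  \<comment> \<open>Read as a lower bound on \<open>g j\<close>, this later removes the unknown
    \<open>g k\<close> from the logarithm.\<close>
  have gap_le: "\<delta> j \<le> g j * D" if "x j \<in> Q" "Fp j \<in> subdiff F Q (x j)" "F (x j) \<le> F (x 0)" for j
  proof -
    have "\<delta> j \<le> Fp j \<bullet> (x j - xs)"
      using that(2) xs_Q by (auto simp: subdiff_def \<delta>_def inner_diff_right)
    also have "\<dots> \<le> g j * nrm (x j - xs)" unfolding g_def by (rule newton.dual_norm_ge)
    also have "\<dots> \<le> g j * D"
      using D_ge[OF that(1,3)] newton.dual_norm_nonneg[of "Fp j"]
      by (intro mult_left_mono) (auto simp: g_def)
    finally show ?thesis .
  qed
  have H_ge: "H 0 \<le> H j" for j by (cases j) (auto simp: H_step)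
  \<comment> \<open>One iteration preserves the invariants. The recurrence is conditional because
    its two premises become available only after the induction in \<open>inv\<close> and the bound
    \<open>\<delta>_ge\<close>.\<close>
  have step: "x (Suc j) \<in> Q \<and> Fp (Suc j) \<in> subdiff F Q (x (Suc j)) \<and> F (x (Suc j)) \<le> F (x j)
      \<and> H (Suc j) \<le> L2
      \<and> (0 \<le> \<delta> (Suc j) \<and> F (x (Suc j)) \<le> F (x 0) \<longrightarrow>
          \<delta> (Suc j) ^ 3 * g (Suc j) \<le> 8 * L2 / 3 * c0 ^ 4 * D ^ 3 * g j * (\<delta> j - \<delta> (Suc j))\<^sup>2)"
    if j: "j < k" and inv: "x j \<in> Q" "Fp j \<in> subdiff F Q (x j)" "H j \<le> L2" for j
  proof -
    have g_pos: "0 < g j" unfolding g_def by (rule newton.dual_norm_pos[OF running[OF j]])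
    have H_pos: "0 < H j" using H_ge[of j] H0 by linarith
    define reg where "reg = (\<lambda>m. 1 / \<sigma> * sqrt (2 ^ m * H j / 3 * g j))"
    have reg_pos: "0 < reg m" for m using sigma g_pos H_pos by (simp add: reg_def)
    define accept where "accept = (\<lambda>m. f (T (reg m) (x j)) \<le> f (x j) + gf (x j) \<bullet> (T (reg m) (x j) - x j)
        + 1/2 * (Hf (x j) (T (reg m) (x j) - x j) \<bullet> (T (reg m) (x j) - x j))
        + 2 ^ m * H j / 6 * (nrm (T (reg m) (x j) - x j)) ^ 3)"
    have i_eq: "i j = (LEAST m. accept m)"
      unfolding i_def[of j] accept_def reg_def Let_def ..
    have accept: "accept m" if m: "L2 \<le> 2 ^ m * H j" for m
    proof -
      let ?y = "T (reg m) (x j)"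
      have y: "?y \<in> Q"
        unfolding T_def using newton.T_is_minimizer(1)[OF inv(1) inv(2)[unfolded F_eq] reg_pos] .
      have "L2 / 6 * nrm (?y - x j) ^ 3 \<le> 2 ^ m * H j / 6 * nrm (?y - x j) ^ 3"
        using m by (intro mult_right_mono) auto
      then show ?thesis
        using newton.cubic_upper_bound[of "x j" "?y - x j"] inv(1) y by (simp add: accept_def)
    qed
    \<comment> \<open>Doubling eventually exceeds \<open>L2\<close>, so the search terminates and
      \<open>LEAST\<close> really picks an accepted exponent.\<close>
    obtain m0 where "L2 / H j < 2 ^ m0" using real_arch_pow[of 2 "L2 / H j"] by auto
    then have "accept m0" using H_pos by (intro accept) (simp add: field_simps)
    then have acc: "accept (i j)" unfolding i_eq by (rule LeastI)
    define M where "M = 2 ^ i j * H j"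
    \<comment> \<open>The trial before the accepted one failed, so its constant is at most
      \<open>L2\<close>; if there was none, the invariant \<open>H j \<le> L2\<close> is used. The
      second conjunct bounds the next \<open>H\<close>; \<open>powr\<close> is needed as its
      exponent may be -1.\<close>
    have M_half: "M \<le> 2 * L2 \<and> 2 powr (real (i j) - 1) * H j \<le> L2"
    proof (cases "i j")
      case 0
      then show ?thesis using inv(3) L2_pos H_pos by (simp add: M_def powr_minus field_simps)
    next
      case (Suc n)
      then have "\<not> accept n" unfolding i_eq by (metis not_less_Least lessI)
      then have "2 ^ n * H j \<le> L2" using accept[of n] by linarith
      then show ?thesis by (simp add: M_def Suc powr_realpow)
    qed
    have "1 * H j \<le> M" unfolding M_def using H_pos by (intro mult_right_mono) auto
    then have M_ge: "H 0 \<le> M" using H_ge[of j] by simp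
    have A_eq: "A j = reg (i j)" by (simp add: A_def reg_def)
    then have A_pos: "0 < A j" using reg_pos by simp
    interpret st: bregman_newton_step nrm f gf Hf Q L2 \<psi> d gd \<sigma> "x j" "Fp j" "A j"
      by unfold_locales (use inv A_pos in \<open>auto simp: F_eq\<close>)
    have q: "st.q = x (Suc j)" by (simp add: st.q_def x_step T_def)
    have w': "st.w' = Fp (Suc j)" by (simp add: st.w'_def q Fp_step)
    define A0 where "A0 = A j * \<sigma>"
    have A0: "0 < A0" "1 / \<sigma> * A0 = A j" "A0 = sqrt (M / 3 * g j)"
      using A_pos sigma g_pos H_pos by (auto simp: A0_def A_eq reg_def M_def)
    have A0_sq: "A0\<^sup>2 = M / 3 * g j" using A0(3) g_pos M_ge H0 by simp
    have r: "M * st.r \<le> 3 * A0"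
    proof -
      have "A0 * st.r \<le> g j" using st.step_length by (simp add: A0_def g_def)
      then have "M * (A0 * st.r) \<le> M * g j" using M_ge H0 by (intro mult_left_mono) auto
      also have "\<dots> = 3 * A0\<^sup>2" by (simp add: A0_sq)
      finally have "A0 * (M * st.r) \<le> A0 * (3 * A0)" by (simp add: power2_eq_square mult_ac)
      then show ?thesis using A0(1) by simp
    qed
    have decr: "A0 * st.r\<^sup>2 / 2 \<le> F (x j) - F (x (Suc j))"
      unfolding A0_def F_eq q[symmetric]
    proof (rule st.decrease)
      show "f st.q \<le> f (x j) + gf (x j) \<bullet> (st.q - x j) + 1/2 * (Hf (x j) (st.q - x j) \<bullet> (st.q - x j))
          + M / 6 * st.r ^ 3"
        using acc unfolding accept_def T_def A_eq[symmetric] st.r_def M_def st.q_def .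
      show "M * st.r \<le> 3 * (A j * \<sigma>)" using r by (simp add: A0_def)
    qed
    have mono: "F (x (Suc j)) \<le> F (x j)"
      using decr A0(1) zero_le_power2[of st.r] by (smt (verit) divide_nonneg_nonneg mult_nonneg_nonneg)
    have rec: "\<delta> (Suc j) ^ 3 * g (Suc j) \<le> 8 * L2 / 3 * c0 ^ 4 * D ^ 3 * g j * (\<delta> j - \<delta> (Suc j))\<^sup>2"
      if nn: "0 \<le> \<delta> (Suc j)" "F (x (Suc j)) \<le> F (x 0)"
    proof (rule gap_recurrence[where s = "1 / \<sigma>" and r = st.r and A\<^sub>0 = A0 and M = M])
      have Q': "x (Suc j) \<in> Q" using st.q by (simp add: q)
      have "\<delta> (Suc j) \<le> (L2 / 2 * st.r\<^sup>2 + A j * st.r) * nrm (x (Suc j) - xs)"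
        using st.new_gap[OF xs_Q] by (simp add: q \<delta>_def F_eq)
      also have "\<dots> \<le> (L2 / 2 * st.r\<^sup>2 + A j * st.r) * D"
        using D_ge[OF Q' nn(2)] L2_pos A_pos st.r_nonneg by (intro mult_left_mono) auto
      finally show "\<delta> (Suc j) \<le> (L2 / 2 * st.r\<^sup>2 + 1 / \<sigma> * A0 * st.r) * D" by (simp only: A0(2))
      show "g (Suc j) \<le> L2 * st.r\<^sup>2 + 1 / \<sigma> * A0 * st.r"
        using st.new_subgradient_dual_norm unfolding A0(2) g_def w' .
      show "A0 * st.r\<^sup>2 / 2 \<le> \<delta> j - \<delta> (Suc j)" using decr by (simp add: \<delta>_def)
      show "0 \<le> g (Suc j)" unfolding g_def by (rule newton.dual_norm_nonneg)
    qed (use H0 M_ge M_half sigma st.r_nonneg D_nonneg g_pos nn A0 A0_sq r in \<open>simp_all add: c0_def\<close>)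
    show ?thesis
      using st.q st.new_subgradient mono M_half H0 rec
      by (auto simp: q w' F_eq H_step)
  qed
  have inv: "x j \<in> Q \<and> Fp j \<in> subdiff F Q (x j) \<and> H j \<le> L2 \<and> F (x j) \<le> F (x 0)" if "j \<le> k" for j
    using that
  proof (induction j)
    case 0
    then show ?case using x0 Fp0 H0 by simp
  next
    case (Suc j)
    then show ?case using step[of j] by (auto intro: order_trans)
  qed
  have mono: "\<delta> (Suc j) \<le> \<delta> j" if "j < k" for j
    using step[OF that] inv[of j] that by (simp add: \<delta>_def)
  have \<delta>_ge: "\<epsilon> \<le> \<delta> j" if "j \<le> k" for j
    using that
  proof (induction rule: inc_induct)
    case base
    then show ?case using gap by (simp add: \<delta>_def)
  next
    case (step n)
    then show ?case using mono[of n] by simp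
  qed
  have gap_j: "\<epsilon> \<le> g j * D" if "j \<le> k" for j
    using gap_le[of j] inv[OF that] \<delta>_ge[OF that] by linarith
  have D_pos: "0 < D" using gap_j[of 0] D_nonneg eps by (cases "D = 0") auto
  \<comment> \<open>\<open>running\<close> covers only \<open>j < k\<close>; at \<open>j = k\<close>
    positivity comes from the gap still being at least \<open>\<epsilon>\<close>.\<close>
  have g_pos: "0 < g j" if "j \<le> k" for j
    using gap_j[OF that] eps D_pos by (smt (verit) mult_nonpos_nonneg)
  \<comment> \<open>Chosen so that \<open>K\<^sup>2\<close> is the constant of
    \<open>gap_recurrence\<close>.\<close>
  define K where "K = 2 * c0\<^sup>2 * sqrt (2 * L2 * D ^ 3 / 3)"
  have K_sq: "K\<^sup>2 = 8 * L2 / 3 * c0 ^ 4 * D ^ 3"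
    using L2_pos D_nonneg by (simp add: K_def power_mult_distrib flip: power_mult)
  have K_nonneg: "0 \<le> K" using L2_pos D_nonneg by (simp add: K_def)
  have "real k \<le> 2 * K * (1 / sqrt (\<delta> k) - 1 / sqrt (\<delta> 0)) + ln (\<delta> 0 / \<delta> k) + ln (g 0 / g k) / 2"
  proof (rule potential_telescoped)
    show "0 < \<delta> j" if "j \<le> k" for j using \<delta>_ge[OF that] eps by linarith
    show "\<delta> (Suc j) ^ 3 * g (Suc j) \<le> K\<^sup>2 * g j * (\<delta> j - \<delta> (Suc j))\<^sup>2" if "j < k" for j
      unfolding K_sq using step[OF that] inv[of j] inv[of "Suc j"] \<delta>_ge[of "Suc j"] that eps by simp
  qed (use g_pos mono K_nonneg in auto)
  \<comment> \<open>The end values are eliminated by \<open>\<delta> k \<ge> \<epsilon>\<close> and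
    \<open>g k * D \<ge> \<epsilon>\<close>.\<close>
  also have "\<dots> \<le> 2 * K * (1 / sqrt \<epsilon>) + ln (\<delta> 0 / \<epsilon>) + ln (g 0 * D / \<epsilon>) / 2"
  proof (intro add_mono mult_left_mono divide_right_mono)
    have pos: "0 < \<delta> 0" "0 < \<delta> k" using \<delta>_ge[of 0] \<delta>_ge[of k] eps by auto
    have "1 / sqrt (\<delta> k) \<le> 1 / sqrt \<epsilon>"
      using \<delta>_ge[of k] eps by (intro divide_left_mono) auto
    moreover have "0 \<le> 1 / sqrt (\<delta> 0)" using pos by simp
    ultimately show "1 / sqrt (\<delta> k) - 1 / sqrt (\<delta> 0) \<le> 1 / sqrt \<epsilon>" by linarith
    show "ln (\<delta> 0 / \<delta> k) \<le> ln (\<delta> 0 / \<epsilon>)"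
      using pos eps \<delta>_ge[of k] by (intro ln_mono divide_left_mono) auto
    have "g 0 * \<epsilon> \<le> g 0 * (g k * D)"
      using gap_j[of k] g_pos[of 0] by (intro mult_left_mono) auto
    then have "g 0 / g k \<le> g 0 * D / \<epsilon>"
      using g_pos[of k] eps by (simp add: field_simps)
    then show "ln (g 0 / g k) \<le> ln (g 0 * D / \<epsilon>)"
      using g_pos[of k] g_pos[of 0] eps D_pos by (intro ln_mono) auto
  qed (use K_nonneg in auto)
  also have "2 * K * (1 / sqrt \<epsilon>) = 4 * c0\<^sup>2 * sqrt (2 * L2 * D ^ 3 / (3 * \<epsilon>))"
    by (simp add: K_def real_sqrt_mult real_sqrt_divide)
  \<comment> \<open>The power 3/2 of \<open>\<epsilon>\<close> collects 1 from the gap ratio and 1/2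
    from the subgradient ratio.\<close>
  also have "4 * c0\<^sup>2 * sqrt (2 * L2 * D ^ 3 / (3 * \<epsilon>)) + ln (\<delta> 0 / \<epsilon>) + ln (g 0 * D / \<epsilon>) / 2
      = 4 * c0\<^sup>2 * sqrt (2 * L2 * D ^ 3 / (3 * \<epsilon>))
        + ln (\<delta> 0 * sqrt (g 0) * sqrt D / \<epsilon> powr (3/2))"
  proof -
    have "0 < \<delta> 0" "0 < g 0" using \<delta>_ge[of 0] g_pos[of 0] eps by auto
    then show ?thesis using eps D_pos
      by (simp add: ln_div ln_mult ln_sqrt ln_powr field_simps)
  qed
  finally show ?thesis by (simp add: Let_def D_def c0_def \<delta>_def g_def)
qed

end
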